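(* Let $W_{\psi,\varphi,\max}$ be the maximal weighted composition operator on $\mathcal F^2$ induced by entire functions $\varphi,\psi$ with $\psi\not\equiv0$. The following assertions are equivalent. (1) The operator $W_{\psi,\varphi,\max}$ is cohyponormal. (2) One of the following cases occurs, for some complex constants $A,B,C,D$: (a) $\varphi(z)=Az+B$ with $A\ne1$, and $\psi(z)=Ce^{Dz}$, where $D=\overline B(1-A)(1-\overline A)^{-1}$; (b) $\varphi(z)=z+B$, and $\psi(z)=Ce^{Dz}$, where $|B|\ge|D|$.
   Context: The Fock space $\mathcal F^2$ is the Hilbert space of entire functions on $\mathbb C$ that are square integrable with respect to $\frac1\pi e^{-|z|^2}\,dV(z)$ ($dV$ is Lebesgue measure on $\mathbb C$), with inner product $\langle f,g\rangle=\frac1\pi\int_{\mathbb C}f(z)\overline{g(z)}e^{-|z|^2}\,dV(z)$. For entire functions $\psi,\varphi$, put $E(\psi,\varphi)f=\psi\cdot (f\circ\varphi)$. The maximal weighted composition operator $W_{\psi,\varphi,\max}$ has domain $\{f\in\mathcal F^2: E(\psi,\varphi)f\in\mathcal F^2\}$ and acts by $W_{\psi,\varphi,\max}f=E(\psi,\varphi)f$. An operator $T$ is cohyponormal if it is closed, densely defined, $\operatorname{dom}(T^* )\subseteq\operatorname{dom}(T)$ and $\|T^*x\|\ge\|Tx\|$ for all $x\in\operatorname{dom}(T^* )$. *)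

theory Defs
  imports "HOL-Complex_Analysis.Complex_Analysis"
begin

definition fock_measure :: "complex measure" where
  "fock_measure = density lborel (\<lambda>z. ennreal (exp (- (cmod z)\<^sup>2) / pi))"

text \<open>Two entire functions that agree almost everywhere are equal, so no quotient is needed:
  the Fock space is a set of functions.\<close>

definition fock :: "(complex \<Rightarrow> complex) set" where
  "fock = {f. f holomorphic_on UNIV \<and> integrable fock_measure (\<lambda>z. (cmod (f z))\<^sup>2)}"

definition fock_inner :: "(complex \<Rightarrow> complex) \<Rightarrow> (complex \<Rightarrow> complex) \<Rightarrow> complex" where
  "fock_inner f g = (LINT z|fock_measure. f z * cnj (g z))"

definition fock_norm :: "(complex \<Rightarrow> complex) \<Rightarrow> real" where
  "fock_norm f = sqrt (Re (fock_inner f f))"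

text \<open>An unbounded operator in the Fock space is a domain together with an action; values of the
  action outside the domain are irrelevant.\<close>

record fock_op =
  op_dom :: "(complex \<Rightarrow> complex) set"
  op_app :: "(complex \<Rightarrow> complex) \<Rightarrow> (complex \<Rightarrow> complex)"

definition linear_op :: "fock_op \<Rightarrow> bool" where
  "linear_op T \<longleftrightarrow>
     op_dom T \<subseteq> fock \<and> op_app T ` op_dom T \<subseteq> fock \<and> (\<lambda>z. 0) \<in> op_dom T \<and>
     (\<forall>f\<in>op_dom T. \<forall>g\<in>op_dom T. (\<lambda>z. f z + g z) \<in> op_dom T \<and>
        op_app T (\<lambda>z. f z + g z) = (\<lambda>z. op_app T f z + op_app T g z)) \<and>
     (\<forall>c. \<forall>f\<in>op_dom T. (\<lambda>z. c * f z) \<in> op_dom T \<and>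
        op_app T (\<lambda>z. c * f z) = (\<lambda>z. c * op_app T f z))"

definition densely_defined :: "fock_op \<Rightarrow> bool" where
  "densely_defined T \<longleftrightarrow>
     (\<forall>f\<in>fock. \<forall>\<epsilon>>0. \<exists>g\<in>op_dom T. fock_norm (\<lambda>z. f z - g z) < \<epsilon>)"

definition closed_op :: "fock_op \<Rightarrow> bool" where
  "closed_op T \<longleftrightarrow>
     (\<forall>u. \<forall>f\<in>fock. \<forall>g\<in>fock.
        (\<forall>n::nat. u n \<in> op_dom T) \<and>
        (\<lambda>n. fock_norm (\<lambda>z. u n z - f z)) \<longlonglongrightarrow> 0 \<and>
        (\<lambda>n. fock_norm (\<lambda>z. op_app T (u n) z - g z)) \<longlonglongrightarrow> 0
        \<longrightarrow> f \<in> op_dom T \<and> op_app T f = g)"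

text \<open>The description in the action is unique precisely when \<open>T\<close> is densely defined; the adjoint is
  only meaningful in that case.\<close>

definition adjoint_op :: "fock_op \<Rightarrow> fock_op" where
  "adjoint_op T = \<lparr>
     op_dom = {g \<in> fock. \<exists>h\<in>fock. \<forall>f\<in>op_dom T. fock_inner (op_app T f) g = fock_inner f h},
     op_app = (\<lambda>g. THE h. h \<in> fock \<and>
                 (\<forall>f\<in>op_dom T. fock_inner (op_app T f) g = fock_inner f h)) \<rparr>"

definition cohyponormal :: "fock_op \<Rightarrow> bool" where
  "cohyponormal T \<longleftrightarrow>
     linear_op T \<and> closed_op T \<and> densely_defined T \<and>
     op_dom (adjoint_op T) \<subseteq> op_dom T \<and>
     (\<forall>f\<in>op_dom (adjoint_op T). fock_norm (op_app (adjoint_op T) f) \<ge> fock_norm (op_app T f))"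

definition weighted_comp ::
    "(complex \<Rightarrow> complex) \<Rightarrow> (complex \<Rightarrow> complex) \<Rightarrow> (complex \<Rightarrow> complex) \<Rightarrow> (complex \<Rightarrow> complex)" where
  "weighted_comp \<psi> \<phi> f = (\<lambda>z. \<psi> z * f (\<phi> z))"

definition W_max :: "(complex \<Rightarrow> complex) \<Rightarrow> (complex \<Rightarrow> complex) \<Rightarrow> fock_op" where
  "W_max \<psi> \<phi> = \<lparr> op_dom = {f \<in> fock. weighted_comp \<psi> \<phi> f \<in> fock}, op_app = weighted_comp \<psi> \<phi> \<rparr>"

lemma holomorphic_imp_borel:
  assumes "f holomorphic_on UNIV"
  shows "f \<in> borel_measurable borel"
  using assms by (intro borel_measurable_continuous_onI holomorphic_on_imp_continuous_on)

lemma fock_inner_eq: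
  assumes "f \<in> fock" "g \<in> fock"
  shows "fock_inner f g = 1 / pi * (LINT z|lborel. f z * cnj (g z) * exp (- (cmod z)\<^sup>2))"
proof -
  have m: "f \<in> borel_measurable borel" "g \<in> borel_measurable borel"
    using assms by (auto simp: fock_def holomorphic_imp_borel)
  have m': "(\<lambda>z. cnj (g z)) \<in> borel_measurable borel"
    by (rule borel_measurable_continuous_on[OF _ m(2)]) (intro continuous_intros)
  have "fock_inner f g = (LINT z|lborel. (exp (- (cmod z)\<^sup>2) / pi) *\<^sub>R (f z * cnj (g z)))"
    unfolding fock_inner_def fock_measure_def using m m'
    by (subst integral_density) (auto intro!: borel_measurable_times)
  also have "\<dots> = (LINT z|lborel. (1 / pi) *\<^sub>R (f z * cnj (g z) * exp (- (cmod z)\<^sup>2)))"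
    by (intro Bochner_Integration.integral_cong) (auto simp: scaleR_conv_of_real)
  finally show ?thesis
    by (simp add: scaleR_conv_of_real)
qed

lemma fock_zero: "(\<lambda>z. 0) \<in> fock"
  by (simp add: fock_def)

lemma fock_scale: "f \<in> fock \<Longrightarrow> (\<lambda>z. c * f z) \<in> fock"
  by (auto simp: fock_def norm_mult power_mult_distrib intro!: holomorphic_intros)

lemma fock_add:
  assumes "f \<in> fock" "g \<in> fock"
  shows "(\<lambda>z. f z + g z) \<in> fock"
proof -
  have h: "(\<lambda>z. f z + g z) holomorphic_on UNIV"
    using assms by (auto simp: fock_def intro!: holomorphic_intros)
  have "integrable fock_measure (\<lambda>z. (cmod (f z + g z))\<^sup>2)"
  proof (rule Bochner_Integration.integrable_bound)
    show "integrable fock_measure (\<lambda>z. 2 * (cmod (f z))\<^sup>2 + 2 * (cmod (g z))\<^sup>2)"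
      using assms by (auto simp: fock_def)
    show "(\<lambda>z. (cmod (f z + g z))\<^sup>2) \<in> borel_measurable fock_measure"
      using holomorphic_imp_borel[OF h] by (simp add: fock_measure_def)
    have "(cmod (a + b))\<^sup>2 \<le> 2 * (cmod a)\<^sup>2 + 2 * (cmod b)\<^sup>2" for a b
    proof -
      have "(cmod (a + b))\<^sup>2 \<le> (cmod a + cmod b)\<^sup>2"
        by (intro power_mono norm_triangle_ineq) auto
      also have "\<dots> \<le> 2 * (cmod a)\<^sup>2 + 2 * (cmod b)\<^sup>2"
        using sum_squares_bound[of "cmod a" "cmod b"] by (simp add: power2_sum)
      finally show ?thesis .
    qed
    then show "AE z in fock_measure. norm ((cmod (f z + g z))\<^sup>2)
                 \<le> norm (2 * (cmod (f z))\<^sup>2 + 2 * (cmod (g z))\<^sup>2)"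
      by simp
  qed
  with h show ?thesis by (simp add: fock_def)
qed

lemma linear_op_W_max: "linear_op (W_max \<psi> \<phi>)"
proof -
  have a: "weighted_comp \<psi> \<phi> (\<lambda>z. f z + g z)
             = (\<lambda>z. weighted_comp \<psi> \<phi> f z + weighted_comp \<psi> \<phi> g z)" for f g
    by (simp add: weighted_comp_def algebra_simps)
  have s: "weighted_comp \<psi> \<phi> (\<lambda>z. c * f z) = (\<lambda>z. c * weighted_comp \<psi> \<phi> f z)" for c f
    by (simp add: weighted_comp_def algebra_simps)
  have z: "weighted_comp \<psi> \<phi> (\<lambda>z. 0) = (\<lambda>z. 0)"
    by (simp add: weighted_comp_def)
  show ?thesis
    by (auto simp: linear_op_def W_max_def a s z fock_zero fock_add fock_scale)
qed

end

theory Submission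
  imports Defs "HOL-Probability.Distributions" "HOL-Real_Asymp.Real_Asymp"
begin

text \<open>Write \<open>K\<^sub>a z = exp (cnj a * z)\<close> for the reproducing kernel. The adjoint of
  \<open>T = W_max \<psi> \<phi>\<close> maps \<open>K\<^sub>a\<close> to \<open>cnj (\<psi> a) K\<^bsub>\<phi> a\<^esub>\<close>, so cohyponormality and the pointwise
  bound \<open>\<bar>f w\<bar> \<le> \<parallel>f\<parallel> exp (\<bar>w\<bar>\<^sup>2 / 2)\<close>, applied to \<open>f = T K\<^sub>a\<close>, give
  \<open>\<bar>\<psi> w exp (cnj a * \<phi> w)\<bar> \<le> \<bar>\<psi> a\<bar> exp ((\<bar>\<phi> a\<bar>\<^sup>2 + \<bar>w\<bar>\<^sup>2) / 2)\<close> for all \<open>a\<close> and \<open>w\<close>. Hence \<open>\<psi>\<close>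
  has no zeros, \<open>\<psi> = exp g\<close>, and the real part of every \<open>g + cnj a * \<phi>\<close> grows at most
  quadratically, which makes \<open>g\<close> a quadratic polynomial and \<open>\<phi>\<close> affine; comparing coefficients
  finishes this direction. Conversely, \<open>T\<^sup>* g z = cnj C * exp (cnj B * z) * g (cnj A * z + cnj D)\<close>, and
  a rigid motion of the plane compares the integrands of \<open>\<parallel>T g\<parallel>\<^sup>2\<close> and \<open>\<parallel>T\<^sup>* g\<parallel>\<^sup>2\<close> pointwise.
  Domains and uniqueness of adjoints rest on the density of the polynomials.\<close>

section \<open>Rotation invariance of planar Lebesgue measure\<close>

text \<open>Values on boxes determine \<open>lborel\<close>, and the preimage of a box under
  \<open>Complex\<close> is a product of intervals. Tonelli's theorem then gives the iterated
  integral.\<close>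

lemma nn_integral_lborel_complex:
  fixes f :: "complex \<Rightarrow> ennreal"
  assumes [measurable]: "f \<in> borel_measurable borel"
  shows "(\<integral>\<^sup>+z. f z \<partial>lborel) = (\<integral>\<^sup>+x. \<integral>\<^sup>+y. f (Complex x y) \<partial>lborel \<partial>lborel)"
proof -
  let ?C = "\<lambda>p. Complex (fst p) (snd p)"
  have "continuous_on UNIV ?C"
    unfolding Complex_eq by (intro continuous_intros)
  then have C [measurable]: "?C \<in> borel_measurable (lborel \<Otimes>\<^sub>M lborel)"
    by (simp add: lborel_prod borel_measurable_continuous_onI)
  have eq: "lborel = distr (lborel \<Otimes>\<^sub>M lborel) borel ?C"
  proof (rule lborel_eqI)
    fix l u :: complex
    assume le: "\<And>b. b \<in> Basis \<Longrightarrow> l \<bullet> b \<le> u \<bullet> b"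
    have le': "Re l \<le> Re u" "Im l \<le> Im u"
      using le[of 1] le[of \<i>] by (auto simp: Basis_complex_def)
    have "?C -` box l u = {Re l<..<Re u} \<times> {Im l<..<Im u}"
      by (auto simp: box_def Basis_complex_def)
    then show "emeasure (distr (lborel \<Otimes>\<^sub>M lborel) borel ?C) (box l u) = (\<Prod>b\<in>Basis. (u - l) \<bullet> b)"
      using le'
      by (simp add: emeasure_distr lborel.emeasure_pair_measure_Times space_pair_measure
          Basis_complex_def ennreal_mult)
  qed simp
  have "(\<integral>\<^sup>+z. f z \<partial>lborel) = (\<integral>\<^sup>+p. f (?C p) \<partial>(lborel \<Otimes>\<^sub>M lborel))"
    by (subst eq, subst nn_integral_distr) auto
  also have "\<dots> = (\<integral>\<^sup>+x. \<integral>\<^sup>+y. f (Complex x y) \<partial>lborel \<partial>lborel)"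
    by (subst lborel.nn_integral_fst[symmetric]) auto
  finally show ?thesis .
qed

lemma measurable_Complex [measurable (raw)]:
  assumes [measurable]: "f \<in> borel_measurable M" "g \<in> borel_measurable M"
  shows "(\<lambda>x. Complex (f x) (g x)) \<in> borel_measurable M"
  unfolding Complex_eq by measurable

lemma nn_integral_lborel_complex':
  fixes f :: "complex \<Rightarrow> ennreal"
  assumes [measurable]: "f \<in> borel_measurable borel"
  shows "(\<integral>\<^sup>+z. f z \<partial>lborel) = (\<integral>\<^sup>+y. \<integral>\<^sup>+x. f (Complex x y) \<partial>lborel \<partial>lborel)"
  unfolding nn_integral_lborel_complex[OF assms]
  by (rule lborel_pair.Fubini'[symmetric]) measurable

text \<open>The shear translates each horizontal line into itself, so integrating over
  \<open>x\<close> first reduces the claim to translation invariance on the real line.\<close>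

lemma nn_integral_shear_Re:
  fixes f :: "complex \<Rightarrow> ennreal" and t :: real
  assumes [measurable]: "f \<in> borel_measurable borel"
  shows "(\<integral>\<^sup>+z. f (z + of_real (t * Im z)) \<partial>lborel) = (\<integral>\<^sup>+z. f z \<partial>lborel)"
proof -
  have "(\<integral>\<^sup>+z. f (z + of_real (t * Im z)) \<partial>lborel)
      = (\<integral>\<^sup>+y. \<integral>\<^sup>+x. f (Complex x y + of_real (t * y)) \<partial>lborel \<partial>lborel)"
    by (subst nn_integral_lborel_complex') auto
  also have "\<dots> = (\<integral>\<^sup>+y. \<integral>\<^sup>+x. f (Complex (t * y + 1 * x) y) \<partial>lborel \<partial>lborel)"
    by (simp add: complex_eq_iff Complex_eq algebra_simps)
  also have "\<dots> = (\<integral>\<^sup>+y. \<integral>\<^sup>+x. f (Complex x y) \<partial>lborel \<partial>lborel)"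
  proof (rule nn_integral_cong)
    fix y
    show "(\<integral>\<^sup>+x. f (Complex (t * y + 1 * x) y) \<partial>lborel) = (\<integral>\<^sup>+x. f (Complex x y) \<partial>lborel)"
      by (subst (2) nn_integral_real_affine[of _ 1 "t * y"]) auto
  qed
  finally show ?thesis
    by (simp add: nn_integral_lborel_complex')
qed

lemma nn_integral_shear_Im:
  fixes f :: "complex \<Rightarrow> ennreal" and t :: real
  assumes [measurable]: "f \<in> borel_measurable borel"
  shows "(\<integral>\<^sup>+z. f (z + \<i> * of_real (t * Re z)) \<partial>lborel) = (\<integral>\<^sup>+z. f z \<partial>lborel)"
proof -
  have "(\<integral>\<^sup>+z. f (z + \<i> * of_real (t * Re z)) \<partial>lborel)
      = (\<integral>\<^sup>+x. \<integral>\<^sup>+y. f (Complex x y + \<i> * of_real (t * x)) \<partial>lborel \<partial>lborel)"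
    by (subst nn_integral_lborel_complex) auto
  also have "\<dots> = (\<integral>\<^sup>+x. \<integral>\<^sup>+y. f (Complex x (t * x + 1 * y)) \<partial>lborel \<partial>lborel)"
    by (simp add: complex_eq_iff Complex_eq algebra_simps)
  also have "\<dots> = (\<integral>\<^sup>+x. \<integral>\<^sup>+y. f (Complex x y) \<partial>lborel \<partial>lborel)"
  proof (rule nn_integral_cong)
    fix x
    show "(\<integral>\<^sup>+y. f (Complex x (t * x + 1 * y)) \<partial>lborel) = (\<integral>\<^sup>+y. f (Complex x y) \<partial>lborel)"
      by (subst (2) nn_integral_real_affine[of _ 1 "t * x"]) auto
  qed
  finally show ?thesis
    by (simp add: nn_integral_lborel_complex)
qed

text \<open>A rotation by an angle other than \<open>\<pi>\<close> is a composition of three shears.\<close>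

lemma nn_integral_rotation_aux:
  fixes f :: "complex \<Rightarrow> ennreal"
  assumes f [measurable]: "f \<in> borel_measurable borel" and c: "cmod c = 1" "c \<noteq> -1"
  shows "(\<integral>\<^sup>+z. f (c * z) \<partial>lborel) = (\<integral>\<^sup>+z. f z \<partial>lborel)"
proof -
  \<comment> \<open>This is minus the tangent of half the argument of \<open>c\<close>; its
    denominator vanishes exactly at the excluded half turn.\<close>
  define t where "t = - Im c / (1 + Re c)"
  define R where "R = (\<lambda>z::complex. z + of_real (t * Im z))"
  define S where "S = (\<lambda>z::complex. z + \<i> * of_real (Im c * Re z))"
  have [measurable]: "R \<in> borel_measurable borel" "S \<in> borel_measurable borel"
    unfolding R_def S_def by measurable
  have n: "(Re c)\<^sup>2 + (Im c)\<^sup>2 = 1"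
    using c(1) by (simp add: cmod_def)
  have "Re c \<noteq> -1"
    using n c(2) by (auto simp: complex_eq_iff)
  then have ne: "1 + Re c \<noteq> 0" by linarith
  have "(Im c)\<^sup>2 = (1 - Re c) * (1 + Re c)"
    using n by (simp add: algebra_simps power2_eq_square)
  then have t1: "t * Im c = Re c - 1"
    using ne by (simp add: t_def field_simps power2_eq_square)
  have "t * (1 + Re c) = - Im c"
    using ne by (simp add: t_def)
  then have t2: "t + t + t * (Re c - 1) = - Im c"
    by (simp add: algebra_simps)
  have eq: "R (S (R z)) = c * z" for z
  proof (rule complex_eqI)
    have "Re (R (S (R z))) = Re z * (1 + t * Im c) + Im z * (t + t + t * (t * Im c))"
      by (simp add: R_def S_def algebra_simps)
    also have "\<dots> = Re (c * z)"
      unfolding t1 t2 by simp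
    finally show "Re (R (S (R z))) = Re (c * z)" .
    have "Im (R (S (R z))) = Im z * (1 + t * Im c) + Re z * Im c"
      by (simp add: R_def S_def algebra_simps)
    also have "\<dots> = Im (c * z)"
      unfolding t1 by simp
    finally show "Im (R (S (R z))) = Im (c * z)" .
  qed
  have "(\<integral>\<^sup>+z. f (c * z) \<partial>lborel) = (\<integral>\<^sup>+z. f (R (S (R z))) \<partial>lborel)"
    by (simp add: eq)
  also have "\<dots> = (\<integral>\<^sup>+z. f (R (S z)) \<partial>lborel)"
    using nn_integral_shear_Re[of "\<lambda>z. f (R (S z))" t] by (simp add: R_def)
  also have "\<dots> = (\<integral>\<^sup>+z. f (R z) \<partial>lborel)"
    using nn_integral_shear_Im[of "\<lambda>z. f (R z)" "Im c"] by (simp add: S_def)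
  also have "\<dots> = (\<integral>\<^sup>+z. f z \<partial>lborel)"
    using nn_integral_shear_Re[of f t] by (simp add: R_def)
  finally show ?thesis .
qed

lemma nn_integral_rotation:
  fixes f :: "complex \<Rightarrow> ennreal"
  assumes f [measurable]: "f \<in> borel_measurable borel" and c: "cmod c = 1"
  shows "(\<integral>\<^sup>+z. f (c * z) \<partial>lborel) = (\<integral>\<^sup>+z. f z \<partial>lborel)"
proof (cases "c = -1")
  case True
  \<comment> \<open>The half turn is a composition of two quarter turns, each of which is a product
    of shears.\<close>
  have i: "\<i> \<noteq> -1" by (simp add: complex_eq_iff)
  have "(\<integral>\<^sup>+z. f (c * z) \<partial>lborel) = (\<integral>\<^sup>+z. f (\<i> * (\<i> * z)) \<partial>lborel)"
    by (simp add: True mult.assoc[symmetric])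
  also have "\<dots> = (\<integral>\<^sup>+z. f (\<i> * z) \<partial>lborel)"
    by (rule nn_integral_rotation_aux[of "\<lambda>z. f (\<i> * z)"]) (auto simp: i)
  also have "\<dots> = (\<integral>\<^sup>+z. f z \<partial>lborel)"
    by (rule nn_integral_rotation_aux) (auto simp: i)
  finally show ?thesis .
next
  case False
  then show ?thesis
    using assms by (intro nn_integral_rotation_aux)
qed

lemma lborel_distr_rigid_motion:
  assumes c: "cmod c = 1"
  shows "distr lborel borel (\<lambda>z. c * z + d) = (lborel :: complex measure)"
proof (rule measure_eqI)
  fix X :: "complex set"
  assume "X \<in> sets (distr lborel borel (\<lambda>z. c * z + d))"
  then have [measurable]: "X \<in> sets borel" by simp
  have "emeasure (distr lborel borel (\<lambda>z. c * z + d)) X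
      = (\<integral>\<^sup>+z. indicator X z \<partial>distr lborel borel (\<lambda>z. c * z + d))"
    by simp
  also have "\<dots> = (\<integral>\<^sup>+z. indicator X (c * z + d) \<partial>lborel)"
    by (rule nn_integral_distr) auto
  also have "\<dots> = (\<integral>\<^sup>+z. indicator X (z + d) \<partial>lborel)"
    by (rule nn_integral_rotation[OF _ c, of "\<lambda>z. indicator X (z + d)"]) measurable
  also have "\<dots> = (\<integral>\<^sup>+z. indicator X z \<partial>distr lborel borel (\<lambda>z. d + z))"
    by (subst nn_integral_distr) (auto simp: add.commute)
  also have "\<dots> = emeasure lborel X"
    by (simp add: lborel_distr_plus)
  finally show "emeasure (distr lborel borel (\<lambda>z. c * z + d)) X = emeasure lborel X" .
qed simp

section \<open>Gaussian integrals on the line and in the plane\<close>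

lemma nn_integral_gaussian_real: "(\<integral>\<^sup>+x. ennreal (exp (- (x::real)\<^sup>2)) \<partial>lborel) = ennreal (sqrt pi)"
proof -
  have "has_bochner_integral lborel (\<lambda>x::real. exp (- x\<^sup>2)) (sqrt pi)"
    using has_bochner_integral_even_function[OF gaussian_moment_0] by simp
  then show ?thesis
    by (simp add: has_bochner_integral_iff nn_integral_eq_integral)
qed

lemma nn_integral_gaussian_complex:
  "(\<integral>\<^sup>+z. ennreal (exp (- (cmod z)\<^sup>2)) \<partial>lborel) = ennreal pi"
proof -
  have "(\<integral>\<^sup>+z. ennreal (exp (- (cmod z)\<^sup>2)) \<partial>lborel)
      = (\<integral>\<^sup>+x. \<integral>\<^sup>+y. ennreal (exp (- x\<^sup>2)) * ennreal (exp (- y\<^sup>2)) \<partial>lborel \<partial>lborel)"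
    by (subst nn_integral_lborel_complex)
       (auto simp: cmod_def exp_add[symmetric] ennreal_mult[symmetric] intro!: nn_integral_cong)
  also have "\<dots> = ennreal (sqrt pi) * ennreal (sqrt pi)"
    by (simp add: nn_integral_cmult nn_integral_multc nn_integral_gaussian_real)
  also have "\<dots> = ennreal pi"
    by (simp add: ennreal_mult[symmetric])
  finally show ?thesis .
qed

section \<open>Circle averages and the Gaussian measure\<close>

lemma borel_measurable_cnj [measurable (raw)]:
  "f \<in> borel_measurable M \<Longrightarrow> (\<lambda>x. cnj (f x)) \<in> borel_measurable M"
  by (rule borel_measurable_continuous_on[OF continuous_on_cnj[OF continuous_on_id]])

text \<open>The period is 1 so that integrals over \<open>{0..1}\<close> are averages over the
  circle and the curve coincides with \<open>circlepath 0 1\<close>.\<close>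

definition unit_circle :: "real \<Rightarrow> complex" where
  "unit_circle t = exp (2 * of_real pi * \<i> * of_real t)"

lemma norm_unit_circle [simp]: "cmod (unit_circle t) = 1"
  by (simp add: unit_circle_def)

lemma unit_circle_ne_0 [simp]: "unit_circle t \<noteq> 0"
  by (simp add: unit_circle_def)

lemma continuous_on_unit_circle [continuous_intros]: "continuous_on S unit_circle"
  unfolding unit_circle_def by (intro continuous_intros)

lemma borel_measurable_unit_circle [measurable]: "unit_circle \<in> borel_measurable borel"
  by (intro borel_measurable_continuous_onI continuous_intros)

lemma cnj_unit_circle: "cnj (unit_circle t) = inverse (unit_circle t)"
  by (simp add: unit_circle_def exp_cnj exp_minus[symmetric])

abbreviation taylor_coeff :: "(complex \<Rightarrow> complex) \<Rightarrow> nat \<Rightarrow> complex" where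
  "taylor_coeff f k \<equiv> (deriv ^^ k) f 0 / fact k"

lemma holomorphic_on_affine_comp:
  assumes "f holomorphic_on UNIV"
  shows "(\<lambda>z. f (a * z + b)) holomorphic_on S"
proof -
  have "(\<lambda>z. a * z + b) holomorphic_on S"
    by (intro holomorphic_intros)
  from holomorphic_on_compose_gen[OF this assms] show ?thesis
    by (simp add: o_def)
qed

text \<open>Cauchy's formula for the \<open>k\<close>-th derivative of \<open>f (w * z)\<close> on
  the unit circle: the conjugate is the inverse there, so dividing by the power \<open>Suc k\<close>
  and multiplying by the derivative of the curve leaves \<open>cnj (unit_circle t) ^ k\<close>. The
  factor \<open>w\<close> allows circles of every radius.\<close>

lemma has_integral_unit_circle:
  assumes f: "f holomorphic_on UNIV"
  shows "((\<lambda>t. f (unit_circle t * w) * cnj (unit_circle t) ^ k)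
           has_integral taylor_coeff f k * w ^ k) {0..1}"
proof -
  let ?F = "\<lambda>z. f (w * z)"
  have F: "?F holomorphic_on S" for S
    using holomorphic_on_affine_comp[OF f, of w 0] by simp
  have circ: "circlepath 0 1 = unit_circle"
    by (auto simp: circlepath unit_circle_def)
  have vd: "vector_derivative unit_circle (at t) = 2 * pi * \<i> * unit_circle t" for t
    using vector_derivative_circlepath[of 0 1 t] by (simp add: circ) (simp add: unit_circle_def)
  have "((\<lambda>u. ?F u / (u - 0) ^ Suc k) has_contour_integral
          (2 * pi * \<i>) / fact k * (deriv ^^ k) ?F 0) (circlepath 0 1)"
    by (intro Cauchy_has_contour_integral_higher_derivative_circlepath
        holomorphic_on_imp_continuous_on F) auto
  then have "((\<lambda>t. ?F (unit_circle t) / unit_circle t ^ Suc k * (2 * pi * \<i> * unit_circle t))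
      has_integral (2 * pi * \<i>) / fact k * (deriv ^^ k) ?F 0) {0..1}"
    unfolding has_contour_integral circ vd by simp
  then have "((\<lambda>t. inverse (2 * pi * \<i>) *
        (?F (unit_circle t) / unit_circle t ^ Suc k * (2 * pi * \<i> * unit_circle t)))
      has_integral inverse (2 * pi * \<i>) * ((2 * pi * \<i>) / fact k * (deriv ^^ k) ?F 0)) {0..1}"
    by (rule has_integral_mult_right)
  moreover have "inverse (2 * pi * \<i>) *
        (?F (unit_circle t) / unit_circle t ^ Suc k * (2 * pi * \<i> * unit_circle t))
      = f (unit_circle t * w) * cnj (unit_circle t) ^ k" for t
    by (simp add: cnj_unit_circle field_simps)
  moreover have "(deriv ^^ k) ?F 0 = w ^ k * (deriv ^^ k) f 0"
    using higher_deriv_compose_linear[OF f open_UNIV open_UNIV, of 0 w k] by simp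
  then have "inverse (2 * pi * \<i>) * ((2 * pi * \<i>) / fact k * (deriv ^^ k) ?F 0)
      = taylor_coeff f k * w ^ k"
    by (simp add: field_simps)
  ultimately show ?thesis by simp
qed

section \<open>The Gaussian measure: densities, total mass and rotation invariance\<close>

lemma fock_memD:
  assumes "f \<in> fock"
  shows "f holomorphic_on UNIV" "integrable fock_measure (\<lambda>z. (cmod (f z))\<^sup>2)"
    "f \<in> borel_measurable borel"
  using assms by (auto simp: fock_def holomorphic_imp_borel)

lemma sets_fock_measure [simp, measurable_cong]: "sets fock_measure = sets borel"
  and space_fock_measure [simp]: "space fock_measure = UNIV"
  by (simp_all add: fock_measure_def)

lemma integrable_fock_measure_iff:
  fixes F :: "complex \<Rightarrow> 'a :: {banach, second_countable_topology}"
  assumes [measurable]: "F \<in> borel_measurable borel"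
  shows "integrable fock_measure F \<longleftrightarrow>
    integrable lborel (\<lambda>z. (exp (- (cmod z)\<^sup>2) / pi) *\<^sub>R F z)"
  unfolding fock_measure_def by (subst integrable_density) auto

lemma integral_fock_measure:
  fixes F :: "complex \<Rightarrow> 'a :: {banach, second_countable_topology}"
  assumes [measurable]: "F \<in> borel_measurable borel"
  shows "(LINT z|fock_measure. F z) = (LINT z|lborel. (exp (- (cmod z)\<^sup>2) / pi) *\<^sub>R F z)"
  unfolding fock_measure_def by (subst integral_density) auto

lemma emeasure_fock_measure: "emeasure fock_measure UNIV = 1"
proof -
  have "emeasure fock_measure UNIV
      = (\<integral>\<^sup>+z. ennreal (inverse pi) * ennreal (exp (- (cmod z)\<^sup>2)) \<partial>lborel)"
    unfolding fock_measure_def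
    by (subst emeasure_density) (auto simp: ennreal_mult[symmetric] field_simps)
  also have "\<dots> = ennreal (inverse pi) * ennreal pi"
    by (simp add: nn_integral_cmult nn_integral_gaussian_complex)
  also have "\<dots> = 1"
    by (simp add: ennreal_mult[symmetric])
  finally show ?thesis .
qed

interpretation fock_measure: prob_space fock_measure
  by (rule prob_spaceI) (simp add: emeasure_fock_measure)

lemma
  fixes F :: "complex \<Rightarrow> 'a :: {banach, second_countable_topology}"
  assumes [measurable]: "F \<in> borel_measurable borel" and c: "cmod c = 1"
  shows integrable_rigid_motion:
      "integrable lborel (\<lambda>z. F (c * z + d)) \<longleftrightarrow> integrable lborel F"
    and integral_rigid_motion:
      "(LINT z|lborel. F (c * z + d)) = (LINT z|lborel. F z)"
proof -
  have "integrable lborel F \<longleftrightarrow> integrable (distr lborel borel (\<lambda>z. c * z + d)) F"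
    by (simp add: lborel_distr_rigid_motion[OF c])
  also have "\<dots> \<longleftrightarrow> integrable lborel (\<lambda>z. F (c * z + d))"
    by (rule integrable_distr_eq) auto
  finally show "integrable lborel (\<lambda>z. F (c * z + d)) \<longleftrightarrow> integrable lborel F" ..
  have "(LINT z|lborel. F z) = (LINT z|distr lborel borel (\<lambda>z. c * z + d). F z)"
    by (simp add: lborel_distr_rigid_motion[OF c])
  also have "\<dots> = (LINT z|lborel. F (c * z + d))"
    by (rule integral_distr) auto
  finally show "(LINT z|lborel. F (c * z + d)) = (LINT z|lborel. F z)" ..
qed

lemma
  fixes F :: "complex \<Rightarrow> 'a :: {banach, second_countable_topology}"
  assumes [measurable]: "F \<in> borel_measurable borel" and c: "cmod c = 1"
  shows integrable_fock_rotation: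
      "integrable fock_measure (\<lambda>z. F (c * z)) \<longleftrightarrow> integrable fock_measure F"
    and integral_fock_rotation:
      "(LINT z|fock_measure. F (c * z)) = (LINT z|fock_measure. F z)"
  using integrable_rigid_motion[OF _ c, of "\<lambda>z. (exp (- (cmod z)\<^sup>2) / pi) *\<^sub>R F z" 0]
    integral_rigid_motion[OF _ c, of "\<lambda>z. (exp (- (cmod z)\<^sup>2) / pi) *\<^sub>R F z" 0]
  by (simp_all add: integrable_fock_measure_iff integral_fock_measure norm_mult c)

text \<open>Averaging over all rotations replaces \<open>f\<close> by its \<open>k\<close>-th Taylor term.\<close>

lemma integral_fock_cnj_power:
  assumes f: "f holomorphic_on UNIV"
    and int: "integrable fock_measure (\<lambda>z. f z * cnj z ^ k)"
  shows "(LINT z|fock_measure. f z * cnj z ^ k)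
    = taylor_coeff f k * of_real (LINT z|fock_measure. cmod z ^ (2 * k))"
proof -
  define U where "U = restrict_space lborel {0..1::real}"
  define F where "F = (\<lambda>z. f z * cnj z ^ k)"
  have [measurable]: "f \<in> borel_measurable borel"
    by (rule holomorphic_imp_borel[OF f])
  have F [measurable]: "F \<in> borel_measurable borel"
    unfolding F_def by measurable
  have intF: "integrable fock_measure F"
    using int by (simp add: F_def)
  have eU: "emeasure U (space U) = 1"
    by (simp add: U_def emeasure_restrict_space space_restrict_space)
  interpret U: prob_space U
    by (rule prob_spaceI) (fact eU)
  interpret pair_sigma_finite U fock_measure ..
  have [measurable]: "unit_circle \<in> borel_measurable U"
    unfolding U_def by (rule measurable_restrict_space1) measurable
  \<comment> \<open>By rotation invariance the inner integral of the norm does not depend on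
    \<open>t\<close>, and a constant is integrable over the probability space
    \<open>U\<close>.\<close>
  have intp: "integrable (U \<Otimes>\<^sub>M fock_measure) (\<lambda>(t, z). F (unit_circle t * z))"
  proof (rule Fubini_integrable)
    show "(\<lambda>(t, z). F (unit_circle t * z)) \<in> borel_measurable (U \<Otimes>\<^sub>M fock_measure)"
      by measurable
    have "(LINT z|fock_measure. norm (case (t, z) of (t, z) \<Rightarrow> F (unit_circle t * z)))
        = (LINT z|fock_measure. norm (F z))" for t
      using integral_fock_rotation[of "\<lambda>z. norm (F z)" "unit_circle t"] by simp
    then show "integrable U (\<lambda>t. LINT z|fock_measure.
        norm (case (t, z) of (t, z) \<Rightarrow> F (unit_circle t * z)))"
      by simp
    show "AE t in U. integrable fock_measure (\<lambda>z. case (t, z) of (t, z) \<Rightarrow> F (unit_circle t * z))"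
      using intF by (simp add: integrable_fock_rotation)
  qed
  have "(LINT z|fock_measure. F z) = (LINT t|U. LINT z|fock_measure. F z)"
    by (simp add: U.prob_space)
  also have "\<dots> = (LINT t|U. LINT z|fock_measure. F (unit_circle t * z))"
    by (simp add: integral_fock_rotation)
  also have "\<dots> = (LINT z|fock_measure. LINT t|U. F (unit_circle t * z))"
    using Fubini_integral[OF intp] by simp
  also have "\<dots> = (LINT z|fock_measure. taylor_coeff f k * of_real (cmod z ^ (2 * k)))"
  proof (rule Bochner_Integration.integral_cong)
    fix z :: complex
    let ?h = "\<lambda>t. f (unit_circle t * z) * cnj (unit_circle t) ^ k"
    have "continuous_on {0..1} ?h"
      using f by (intro continuous_intros continuous_on_compose2[OF holomorphic_on_imp_continuous_on[OF f]]) auto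
    then have "set_integrable lborel {0..1} ?h"
      by (rule borel_integrable_atLeastAtMost')
    then have "(LINT t:{0..1}|lborel. ?h t) = integral {0..1} ?h"
      by (rule set_borel_integral_eq_integral)
    then have *: "(LINT t|U. ?h t) = taylor_coeff f k * z ^ k"
      using has_integral_unit_circle[OF f, of z k]
      by (simp add: U_def integral_restrict_space set_lebesgue_integral_def integral_unique)
    have "(LINT t|U. F (unit_circle t * z)) = (LINT t|U. ?h t * cnj z ^ k)"
      by (simp add: F_def power_mult_distrib mult_ac)
    also have "\<dots> = taylor_coeff f k * (z ^ k * cnj z ^ k)"
      by (subst integral_mult_left_zero) (simp add: *)
    also have "z ^ k * cnj z ^ k = of_real (cmod z ^ (2 * k))"
      by (metis complex_norm_square of_real_power power_mult power_mult_distrib)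
    finally show "(LINT t|U. F (unit_circle t * z))
        = taylor_coeff f k * of_real (cmod z ^ (2 * k))" .
  qed simp
  finally show ?thesis
    by (simp add: F_def del: of_real_power)
qed

lemma integral_fock_mean_value:
  assumes "f holomorphic_on UNIV" "integrable fock_measure f"
  shows "(LINT z|fock_measure. f z) = f 0"
  using integral_fock_cnj_power[of f 0] assms fock_measure.prob_space by simp

section \<open>The Fock space and its reproducing kernel\<close>

lemma fock_uminus: "f \<in> fock \<Longrightarrow> (\<lambda>z. - f z) \<in> fock"
  using fock_scale[of f "-1"] by simp

lemma fock_diff:
  assumes "f \<in> fock" "g \<in> fock"
  shows "(\<lambda>z. f z - g z) \<in> fock"
  using fock_add[OF assms(1) fock_uminus[OF assms(2)]] by simp

lemma fock_sum:
  assumes "\<And>i. i \<in> I \<Longrightarrow> f i \<in> fock"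
  shows "(\<lambda>z. \<Sum>i\<in>I. f i z) \<in> fock"
  using assms by (induction I rule: infinite_finite_induct) (auto intro!: fock_zero fock_add)

lemma integrable_fock_inner:
  assumes "f \<in> fock" "g \<in> fock"
  shows "integrable fock_measure (\<lambda>z. f z * cnj (g z))"
proof (rule Bochner_Integration.integrable_bound)
  note [measurable] = fock_memD(3)[OF assms(1)] fock_memD(3)[OF assms(2)]
  show "integrable fock_measure (\<lambda>z. (cmod (f z))\<^sup>2 + (cmod (g z))\<^sup>2)"
    using assms by (auto dest: fock_memD)
  show "(\<lambda>z. f z * cnj (g z)) \<in> borel_measurable fock_measure"
    by measurable
  have "cmod a * cmod b \<le> (cmod a)\<^sup>2 + (cmod b)\<^sup>2" for a b
    using sum_squares_bound[of "cmod a" "cmod b"] mult_nonneg_nonneg[OF norm_ge_zero norm_ge_zero, of a b] by linarith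
  then show "AE z in fock_measure. norm (f z * cnj (g z)) \<le> norm ((cmod (f z))\<^sup>2 + (cmod (g z))\<^sup>2)"
    by (simp add: norm_mult)
qed

lemma fock_inner_diff_left:
  assumes "f \<in> fock" "g \<in> fock" "h \<in> fock"
  shows "fock_inner (\<lambda>z. f z - g z) h = fock_inner f h - fock_inner g h"
  using assms unfolding fock_inner_def
  by (simp add: left_diff_distrib integrable_fock_inner)

lemma fock_inner_scale_left: "fock_inner (\<lambda>z. c * f z) g = c * fock_inner f g"
  unfolding fock_inner_def by (simp add: mult.assoc)

lemma fock_inner_commute: "fock_inner g f = cnj (fock_inner f g)"
  unfolding fock_inner_def by (subst Bochner_Integration.integral_cnj[symmetric]) (simp add: mult.commute)

lemma fock_inner_diff_right:
  assumes "f \<in> fock" "g \<in> fock" "h \<in> fock"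
  shows "fock_inner h (\<lambda>z. f z - g z) = fock_inner h f - fock_inner h g"
  using fock_inner_diff_left[OF assms]
  by (metis complex_cnj_diff fock_inner_commute)

lemma fock_inner_scale_right: "fock_inner g (\<lambda>z. c * f z) = cnj c * fock_inner g f"
  by (metis complex_cnj_mult fock_inner_commute fock_inner_scale_left)

lemma fock_inner_sum_left:
  assumes "\<And>i. i \<in> I \<Longrightarrow> f i \<in> fock" "g \<in> fock"
  shows "fock_inner (\<lambda>z. \<Sum>i\<in>I. f i z) g = (\<Sum>i\<in>I. fock_inner (f i) g)"
  using assms unfolding fock_inner_def
  by (simp add: sum_distrib_right Bochner_Integration.integral_sum integrable_fock_inner)

lemma fock_inner_sum_right:
  assumes "\<And>i. i \<in> I \<Longrightarrow> f i \<in> fock" "g \<in> fock"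
  shows "fock_inner g (\<lambda>z. \<Sum>i\<in>I. f i z) = (\<Sum>i\<in>I. fock_inner g (f i))"
  by (subst fock_inner_commute) (simp add: fock_inner_sum_left[OF assms] fock_inner_commute[of g])

lemma fock_inner_self: "fock_inner f f = of_real (LINT z|fock_measure. (cmod (f z))\<^sup>2)"
  unfolding fock_inner_def integral_complex_of_real[symmetric]
  by (intro Bochner_Integration.integral_cong) (simp_all add: complex_norm_square[symmetric])

lemma fock_norm_eq: "fock_norm f = sqrt (LINT z|fock_measure. (cmod (f z))\<^sup>2)"
  by (simp add: fock_norm_def fock_inner_self)

lemma fock_norm_nonneg [simp]: "fock_norm f \<ge> 0"
  by (simp add: fock_norm_eq)

lemma fock_norm_square: "(fock_norm f)\<^sup>2 = (LINT z|fock_measure. (cmod (f z))\<^sup>2)"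
  by (simp add: fock_norm_eq)

lemma fock_inner_self_norm: "fock_inner f f = of_real ((fock_norm f)\<^sup>2)"
  by (simp add: fock_inner_self fock_norm_square)

lemma fock_norm_square_diff:
  assumes "f \<in> fock" "g \<in> fock"
  shows "(fock_norm (\<lambda>z. f z - g z))\<^sup>2
    = (fock_norm f)\<^sup>2 - 2 * Re (fock_inner f g) + (fock_norm g)\<^sup>2"
proof -
  have "complex_of_real ((fock_norm (\<lambda>z. f z - g z))\<^sup>2)
      = fock_inner (\<lambda>z. f z - g z) (\<lambda>z. f z - g z)"
    by (simp only: fock_inner_self_norm)
  also have "\<dots> = of_real ((fock_norm f)\<^sup>2) - (fock_inner f g + cnj (fock_inner f g))
      + of_real ((fock_norm g)\<^sup>2)"
    unfolding fock_inner_diff_left[OF assms fock_diff[OF assms]] fock_inner_diff_right[OF assms assms(1)]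
      fock_inner_diff_right[OF assms assms(2)] fock_inner_commute[of g f] fock_inner_self_norm
    by simp
  finally show ?thesis
    unfolding complex_add_cnj by (simp only: of_real_eq_iff flip: of_real_add of_real_diff)
qed

lemma fock_norm_scale: "fock_norm (\<lambda>z. c * f z) = cmod c * fock_norm f"
  by (simp add: fock_norm_eq norm_mult power_mult_distrib real_sqrt_mult)

lemma fock_Cauchy_Schwarz:
  assumes "f \<in> fock" "g \<in> fock"
  shows "cmod (fock_inner f g) \<le> fock_norm f * fock_norm g"
proof -
  define w where "w = fock_inner f g"
  define a where "a = (fock_norm f)\<^sup>2"
  define b where "b = (fock_norm g)\<^sup>2"
  \<comment> \<open>Scaling \<open>g\<close> by \<open>t * w\<close> with \<open>w\<close> the inner
    product itself makes the cross term real, so a quadratic inequality in the real variable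
    \<open>t\<close> remains.\<close>
  have ineq: "2 * t * (cmod w)\<^sup>2 \<le> a + t\<^sup>2 * (cmod w)\<^sup>2 * b" for t :: real
  proof -
    have "0 \<le> (fock_norm (\<lambda>z. f z - of_real t * w * g z))\<^sup>2"
      by simp
    also have "\<dots> = a - 2 * Re (cnj (of_real t * w) * w) + (cmod (of_real t * w))\<^sup>2 * b"
      using assms
      by (simp add: fock_norm_square_diff fock_scale fock_inner_scale_right fock_norm_scale
          a_def b_def w_def power_mult_distrib del: complex_cnj_mult)
    also have "Re (cnj (of_real t * w) * w) = t * (cmod w)\<^sup>2"
      unfolding cmod_power2 by (simp add: power2_eq_square algebra_simps)
    finally show ?thesis
      by (simp add: norm_mult power_mult_distrib)
  qed
  have "(cmod w)\<^sup>2 \<le> a * b"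
  proof (cases "b = 0")
    case True
    have "(cmod w)\<^sup>2 = 0"
    proof (rule ccontr)
      assume "(cmod w)\<^sup>2 \<noteq> 0"
      \<comment> \<open>With \<open>b = 0\<close> the inequality is linear in \<open>t\<close>; this
        \<open>t\<close> makes its left side \<open>a + 1\<close> and its right side
        \<open>a\<close>.\<close>
      then show False
        using ineq[of "(a + 1) / (2 * (cmod w)\<^sup>2)"] True by simp
    qed
    then show ?thesis using True by simp
  next
    case False
    then have "b > 0" by (simp add: b_def)
    then show ?thesis
      using ineq[of "1 / b"] by (simp add: field_simps power2_eq_square)
  qed
  then have "(cmod w)\<^sup>2 \<le> (fock_norm f * fock_norm g)\<^sup>2"
    by (simp add: a_def b_def power_mult_distrib)
  then show ?thesis
    unfolding w_def by (rule power2_le_imp_le) simp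
qed

section \<open>Growth criteria for membership in the Fock space\<close>

lemma integrable_gaussian_complex_half:
  "integrable lborel (\<lambda>z. exp (- (cmod z)\<^sup>2 / 2))"
proof -
  have g2: "(\<integral>\<^sup>+x. ennreal (exp (- (x\<^sup>2 / 2))) \<partial>lborel) = ennreal (sqrt 2) * ennreal (sqrt pi)"
    by (subst nn_integral_real_affine[of _ "sqrt 2" 0]) (auto simp: power_mult_distrib nn_integral_gaussian_real)
  have "(\<integral>\<^sup>+z. ennreal (exp (- (cmod z)\<^sup>2 / 2)) \<partial>lborel)
      = (\<integral>\<^sup>+x. \<integral>\<^sup>+y. ennreal (exp (- x\<^sup>2 / 2)) * ennreal (exp (- y\<^sup>2 / 2)) \<partial>lborel \<partial>lborel)"
    by (subst nn_integral_lborel_complex)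
       (auto simp: cmod_def exp_add[symmetric] ennreal_mult[symmetric] diff_divide_distrib
         intro!: nn_integral_cong)
  also have "\<dots> = (ennreal (sqrt 2) * ennreal (sqrt pi)) * (ennreal (sqrt 2) * ennreal (sqrt pi))"
    by (simp add: nn_integral_cmult nn_integral_multc g2)
  also have "\<dots> < \<infinity>"
    by (simp add: ennreal_mult_less_top)
  finally show ?thesis
    by (intro integrableI_bounded) auto
qed

lemma fock_memI_exponential_type:
  assumes f: "f holomorphic_on UNIV"
    and bound: "\<And>z. cmod (f z) \<le> M * exp (c * cmod z)"
  shows "f \<in> fock"
proof -
  have [measurable]: "f \<in> borel_measurable borel"
    by (rule holomorphic_imp_borel[OF f])
  have "integrable lborel (\<lambda>z. (exp (- (cmod z)\<^sup>2) / pi) *\<^sub>R (cmod (f z))\<^sup>2)"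
  proof (rule Bochner_Integration.integrable_bound)
    show "integrable lborel (\<lambda>z::complex. M\<^sup>2 * exp (2 * c\<^sup>2) / pi * exp (- (cmod z)\<^sup>2 / 2))"
      using integrable_gaussian_complex_half by (intro integrable_mult_right)
    have "exp (- (cmod z)\<^sup>2) / pi * (cmod (f z))\<^sup>2
        \<le> M\<^sup>2 * exp (2 * c\<^sup>2) / pi * exp (- (cmod z)\<^sup>2 / 2)" for z
    proof -
      \<comment> \<open>This square gives \<open>2 * c * cmod z <= 2 * c^2 + (cmod z)^2 / 2\<close>,
        so the growth of \<open>f\<close> uses up only half of the Gaussian exponent.\<close>
      have sq: "0 \<le> (2 * c - cmod z)\<^sup>2" by simp
      have "exp (- (cmod z)\<^sup>2) * (cmod (f z))\<^sup>2 \<le> exp (- (cmod z)\<^sup>2) * (M * exp (c * cmod z))\<^sup>2"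
        by (intro mult_left_mono power_mono bound) auto
      also have "\<dots> = M\<^sup>2 * exp (2 * c * cmod z - (cmod z)\<^sup>2)"
        by (simp add: power_mult_distrib exp_diff exp_minus field_simps flip: exp_double)
      also have "\<dots> \<le> M\<^sup>2 * exp (2 * c\<^sup>2 + - (cmod z)\<^sup>2 / 2)"
        using sq by (intro mult_left_mono) (auto simp: power2_diff power_mult_distrib)
      also have "exp (2 * c\<^sup>2 + - (cmod z)\<^sup>2 / 2) = exp (2 * c\<^sup>2) * exp (- (cmod z)\<^sup>2 / 2)"
        by (rule exp_add)
      finally show ?thesis
        by (simp add: divide_right_mono mult_ac)
    qed
    then show "AE z in lborel. norm ((exp (- (cmod z)\<^sup>2) / pi) *\<^sub>R (cmod (f z))\<^sup>2)
        \<le> norm (M\<^sup>2 * exp (2 * c\<^sup>2) / pi * exp (- (cmod z)\<^sup>2 / 2))"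
      by simp
  qed measurable
  then show ?thesis
    using f by (simp add: fock_def integrable_fock_measure_iff)
qed

text \<open>One family covers the monomials, the kernels and the images of monomials under the
  operators of the theorem. A power is dominated by an exponential, being one term of its series, so
  the growth is of exponential type.\<close>

lemma fock_affine_power_exp:
  "(\<lambda>z. C * exp (D * z) * (A * z + B) ^ k) \<in> fock"
proof (rule fock_memI_exponential_type)
  show "(\<lambda>z. C * exp (D * z) * (A * z + B) ^ k) holomorphic_on UNIV"
    by (intro holomorphic_intros)
  fix z
  have pow: "x ^ k \<le> fact k * exp x" if "x \<ge> 0" for x :: real
  proof -
    have "(\<lambda>n. x ^ n /\<^sub>R fact n) sums exp x"
      by (rule exp_converges)
    then have "(\<Sum>n\<in>{k}. x ^ n /\<^sub>R fact n) \<le> exp x"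
      using that by (metis (no_types, lifting) sums_iff sum_le_suminf finite.emptyI finite.insertI
          zero_le_power fact_ge_zero scaleR_nonneg_nonneg inverse_nonnegative_iff_nonnegative)
    then show ?thesis
      by (simp add: field_simps)
  qed
  have "cmod (A * z + B) ^ k \<le> fact k * exp (cmod (A * z + B))"
    by (rule pow) simp
  also have "\<dots> \<le> fact k * exp (cmod A * cmod z + cmod B)"
    using norm_triangle_ineq[of "A * z" B] by (simp add: norm_mult)
  finally have p: "cmod (A * z + B) ^ k \<le> fact k * exp (cmod A * cmod z + cmod B)" .
  have "cmod (C * exp (D * z) * (A * z + B) ^ k)
      \<le> cmod C * exp (cmod D * cmod z) * (fact k * exp (cmod A * cmod z + cmod B))"
    unfolding norm_mult norm_power
    using norm_exp[of "D * z"] by (intro mult_mono p) (auto simp: norm_mult)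
  also have "\<dots> = cmod C * fact k * exp (cmod B) * exp ((cmod A + cmod D) * cmod z)"
    by (simp add: exp_add algebra_simps)
  finally show "cmod (C * exp (D * z) * (A * z + B) ^ k)
      \<le> cmod C * fact k * exp (cmod B) * exp ((cmod A + cmod D) * cmod z)" .
qed

lemma fock_power: "(\<lambda>z. z ^ k) \<in> fock"
  using fock_affine_power_exp[of 1 0 1 0 k] by simp

section \<open>The reproducing kernel and the pointwise bound\<close>

definition fock_kernel :: "complex \<Rightarrow> complex \<Rightarrow> complex" where
  "fock_kernel a z = exp (cnj a * z)"

lemma fock_kernel_mem: "fock_kernel a \<in> fock"
  using fock_affine_power_exp[of 1 "cnj a" 0 0 0] by (simp add: fock_kernel_def[abs_def])

text \<open>Translating by \<open>a\<close> turns the reproducing property into the mean value property of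
  \<open>f (v + a) * exp (- cnj a * v)\<close> at the origin.\<close>

lemma fock_reproducing:
  assumes f: "f \<in> fock"
  shows "fock_inner f (fock_kernel a) = f a"
proof -
  note [measurable] = fock_memD(3)[OF f] fock_memD(3)[OF fock_kernel_mem]
  define F where "F = (\<lambda>z. (exp (- (cmod z)\<^sup>2) / pi) *\<^sub>R (f z * cnj (fock_kernel a z)))"
  define g where "g = (\<lambda>v. f (v + a) * exp (- cnj a * v))"
  have [measurable]: "F \<in> borel_measurable borel"
    unfolding F_def by measurable
  have g: "g holomorphic_on UNIV"
    unfolding g_def using holomorphic_on_affine_comp[OF fock_memD(1)[OF f], of 1 a UNIV]
    by (intro holomorphic_intros) auto
  then have [measurable]: "g \<in> borel_measurable borel"
    by (rule holomorphic_imp_borel)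
  have eq: "(exp (- (cmod v)\<^sup>2) / pi) *\<^sub>R g v = F (1 * v + a)" for v
  proof -
    have "of_real (- (cmod v)\<^sup>2) + - cnj a * v = of_real (- (cmod (v + a))\<^sup>2) + a * cnj (v + a)"
      by (simp add: complex_norm_square algebra_simps del: of_real_power)
    then have "exp (of_real (- (cmod v)\<^sup>2)) * exp (- cnj a * v)
        = exp (of_real (- (cmod (v + a))\<^sup>2)) * exp (a * cnj (v + a))"
      by (simp only: exp_add[symmetric])
    then have "of_real (exp (- (cmod v)\<^sup>2)) * exp (- cnj a * v)
        = of_real (exp (- (cmod (v + a))\<^sup>2)) * exp (a * cnj (v + a))"
      by (simp only: exp_of_real)
    then show ?thesis
      by (simp add: F_def g_def fock_kernel_def scaleR_conv_of_real exp_cnj mult_ac)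
  qed
  have "integrable lborel F"
    using integrable_fock_inner[OF f fock_kernel_mem] by (simp add: F_def integrable_fock_measure_iff)
  then have "integrable fock_measure g"
    using integrable_rigid_motion[of F 1 a] by (simp add: integrable_fock_measure_iff eq)
  then have "(LINT v|fock_measure. g v) = g 0"
    by (rule integral_fock_mean_value[OF g])
  moreover have "(LINT v|fock_measure. g v) = (LINT z|lborel. F z)"
    using integral_rigid_motion[of F 1 a] by (simp add: integral_fock_measure eq)
  moreover have "fock_inner f (fock_kernel a) = (LINT z|lborel. F z)"
    by (simp add: fock_inner_def integral_fock_measure F_def)
  ultimately show ?thesis
    by (simp add: g_def)
qed

lemma fock_norm_kernel: "fock_norm (fock_kernel a) = exp ((cmod a)\<^sup>2 / 2)"
proof -
  have "complex_of_real ((fock_norm (fock_kernel a))\<^sup>2) = exp (of_real ((cmod a)\<^sup>2))"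
    using fock_reproducing[OF fock_kernel_mem, of a a]
    by (simp add: fock_inner_self_norm fock_kernel_def complex_norm_square mult.commute del: of_real_power)
  then have "(fock_norm (fock_kernel a))\<^sup>2 = (exp ((cmod a)\<^sup>2 / 2))\<^sup>2"
    by (simp add: exp_of_real del: of_real_power flip: exp_double)
  then show ?thesis
    by (simp add: power2_eq_iff_nonneg)
qed

lemma fock_pointwise_bound:
  assumes "f \<in> fock"
  shows "cmod (f a) \<le> fock_norm f * exp ((cmod a)\<^sup>2 / 2)"
  using fock_Cauchy_Schwarz[OF assms fock_kernel_mem, of a]
  by (simp add: fock_reproducing[OF assms] fock_norm_kernel)

section \<open>Density of polynomials\<close>

text \<open>The known value is \<open>fact k\<close>; below, the number serves as a nonnegative
  weight of the \<open>k\<close>-th Taylor coefficient.\<close>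

definition monomial_norm_sq :: "nat \<Rightarrow> real" where
  "monomial_norm_sq k = (LINT z|fock_measure. cmod z ^ (2 * k))"

lemma fock_inner_power:
  assumes "f \<in> fock"
  shows "fock_inner f (\<lambda>z. z ^ k) = taylor_coeff f k * of_real (monomial_norm_sq k)"
  using integral_fock_cnj_power[OF fock_memD(1)[OF assms], of k]
    integrable_fock_inner[OF assms fock_power, of k]
  by (simp add: fock_inner_def monomial_norm_sq_def)

lemma taylor_coeff_power: "taylor_coeff (\<lambda>z. z ^ j) k = (if j = k then 1 else 0)"
proof -
  have eq: "(deriv ^^ k) (\<lambda>z. z ^ j) 0 = pochhammer (of_nat (Suc j - k) :: complex) k * 0 ^ (j - k)"
    using higher_deriv_power[of k 0 j 0] by simp
  consider "j < k" | "j = k" | "j > k" by linarith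
  then show ?thesis
  proof cases
    case 1
    \<comment> \<open>For \<open>j < k\<close> the truncated difference \<open>Suc j - k\<close> is
      0, so the first factor of the rising factorial is 0.\<close>
    then have "pochhammer (of_nat (Suc j - k) :: complex) k = 0"
      by (auto simp: pochhammer_0_left)
    then show ?thesis using eq 1 by simp
  next
    case 2
    then show ?thesis using eq by (simp add: pochhammer_fact[symmetric])
  next
    case 3
    then show ?thesis using eq by simp
  qed
qed

lemma fock_inner_power_power:
  "fock_inner (\<lambda>z. z ^ j) (\<lambda>z. z ^ k) = (if j = k then of_real (monomial_norm_sq k) else 0)"
  by (simp add: fock_inner_power[OF fock_power] taylor_coeff_power)

lemma monomial_norm_sq_nonneg: "monomial_norm_sq k \<ge> 0"
  by (simp add: monomial_norm_sq_def)

lemma fock_polynomial: "(\<lambda>z. \<Sum>k\<in>I. a k * z ^ k) \<in> fock"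
  by (intro fock_sum fock_scale fock_power)

lemma fock_norm_polynomial:
  assumes "finite I"
  shows "(fock_norm (\<lambda>z. \<Sum>k\<in>I. a k * z ^ k))\<^sup>2 = (\<Sum>k\<in>I. (cmod (a k))\<^sup>2 * monomial_norm_sq k)"
proof -
  have m: "(\<lambda>z. a k * z ^ k) \<in> fock" for k
    by (intro fock_scale fock_power)
  have "complex_of_real ((fock_norm (\<lambda>z. \<Sum>k\<in>I. a k * z ^ k))\<^sup>2)
      = (\<Sum>j\<in>I. \<Sum>k\<in>I. cnj (a k) * (a j * (if j = k then of_real (monomial_norm_sq k) else 0)))"
    by (simp only: fock_inner_self_norm[symmetric] fock_inner_sum_left[OF m fock_polynomial]
        fock_inner_sum_right[OF m m] fock_inner_scale_right fock_inner_scale_left fock_inner_power_power)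
  also have "\<dots> = (\<Sum>j\<in>I. of_real ((cmod (a j))\<^sup>2 * monomial_norm_sq j))"
    using assms
    by (intro sum.cong) (simp_all add: if_distrib sum.delta complex_norm_square mult_ac cong: if_cong del: of_real_power)
  finally show ?thesis
    by (simp only: of_real_sum[symmetric] of_real_eq_iff)
qed

definition taylor_poly :: "(complex \<Rightarrow> complex) \<Rightarrow> nat \<Rightarrow> complex \<Rightarrow> complex" where
  "taylor_poly f n z = (\<Sum>k<n. taylor_coeff f k * z ^ k)"

lemma fock_taylor_poly: "taylor_poly f n \<in> fock"
  unfolding taylor_poly_def[abs_def] by (rule fock_polynomial)

text \<open>The Taylor polynomial \<open>p\<close> is the orthogonal projection of \<open>f\<close>
  onto the span of its monomials: the inner product of \<open>f\<close> with \<open>p\<close> equals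
  the squared norm of \<open>p\<close>, and the squared norm of \<open>f - p\<close> is
  nonnegative.\<close>

lemma fock_Bessel:
  assumes "f \<in> fock"
  shows "(\<Sum>k<n. (cmod (taylor_coeff f k))\<^sup>2 * monomial_norm_sq k) \<le> (fock_norm f)\<^sup>2"
proof -
  let ?a = "taylor_coeff f"
  have m: "(\<lambda>z. ?a k * z ^ k) \<in> fock" for k
    by (intro fock_scale fock_power)
  have "fock_inner f (taylor_poly f n) = (\<Sum>k<n. cnj (?a k) * (?a k * of_real (monomial_norm_sq k)))"
    by (simp only: taylor_poly_def[abs_def] fock_inner_sum_right[OF m assms] fock_inner_scale_right
        fock_inner_power[OF assms])
  also have "\<dots> = (\<Sum>k<n. of_real ((cmod (?a k))\<^sup>2 * monomial_norm_sq k))"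
    by (intro sum.cong) (simp_all add: complex_norm_square mult_ac del: of_real_power)
  finally have "Re (fock_inner f (taylor_poly f n)) = (\<Sum>k<n. (cmod (?a k))\<^sup>2 * monomial_norm_sq k)"
    by (simp only: of_real_sum[symmetric] Re_complex_of_real)
  moreover have "(fock_norm (taylor_poly f n))\<^sup>2 = (\<Sum>k<n. (cmod (?a k))\<^sup>2 * monomial_norm_sq k)"
    unfolding taylor_poly_def[abs_def] by (rule fock_norm_polynomial) simp
  moreover have "0 \<le> (fock_norm (\<lambda>z. f z - taylor_poly f n z))\<^sup>2"
    by simp
  ultimately show ?thesis
    unfolding fock_norm_square_diff[OF assms fock_taylor_poly] by linarith
qed

lemma nn_integral_fock_norm:
  assumes "f \<in> fock"
  shows "(\<integral>\<^sup>+z. ennreal ((cmod (f z))\<^sup>2) \<partial>fock_measure) = ennreal ((fock_norm f)\<^sup>2)"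
  using fock_memD(2)[OF assms] by (simp add: fock_norm_square nn_integral_eq_integral)

text \<open>Bessel's inequality bounds the norms of the differences of Taylor polynomials by tails of a
  convergent series; Fatou's lemma carries the bound over to the pointwise limit.\<close>

lemma taylor_poly_dense:
  assumes f: "f \<in> fock" and e: "\<epsilon> > 0"
  shows "\<exists>n. fock_norm (\<lambda>z. f z - taylor_poly f n z) < \<epsilon>"
proof -
  define b where "b = (\<lambda>k. (cmod (taylor_coeff f k))\<^sup>2 * monomial_norm_sq k)"
  have b0: "b k \<ge> 0" for k
    by (simp add: b_def monomial_norm_sq_nonneg)
  have "summable b"
    using fock_Bessel[OF f] b0 by (intro summableI_nonneg_bounded[where x = "(fock_norm f)\<^sup>2"]) (auto simp: b_def)
  moreover have "\<epsilon>\<^sup>2 / 2 > 0" using e by simp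
  \<comment> \<open>Half of the squared tolerance leaves room for the strict inequality, since only
    a non-strict bound survives the limit.\<close>
  ultimately obtain n where n: "\<And>m. norm (\<Sum>k\<in>{n..<m}. b k) < \<epsilon>\<^sup>2 / 2"
    by (metis order_refl summable_Cauchy)
  have [measurable]: "f \<in> borel_measurable borel" "taylor_poly f m \<in> borel_measurable borel" for m
    using fock_memD(3)[OF f] fock_memD(3)[OF fock_taylor_poly] .
  have lim: "(\<lambda>m. taylor_poly f m z) \<longlonglongrightarrow> f z" for z
    using holomorphic_power_series[of f 0 "cmod z + 1" z] fock_memD(1)[OF f]
    by (auto simp: sums_def taylor_poly_def intro: holomorphic_on_subset)
  have bound: "(\<integral>\<^sup>+z. ennreal ((cmod (taylor_poly f m z - taylor_poly f n z))\<^sup>2) \<partial>fock_measure)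
      \<le> ennreal (\<epsilon>\<^sup>2 / 2)" if "m \<ge> n" for m
  proof -
    have "taylor_poly f m z - taylor_poly f n z = (\<Sum>k\<in>{n..<m}. taylor_coeff f k * z ^ k)" for z
      unfolding taylor_poly_def lessThan_atLeast0 using that by (intro sum_diff_nat_ivl) auto
    then have "(fock_norm (\<lambda>z. taylor_poly f m z - taylor_poly f n z))\<^sup>2 = (\<Sum>k\<in>{n..<m}. b k)"
      by (simp only: fock_norm_polynomial[OF finite_atLeastLessThan] b_def)
    also have "\<dots> \<le> \<epsilon>\<^sup>2 / 2"
      using n[of m] by (simp add: abs_less_iff less_imp_le)
    finally show ?thesis
      by (simp add: nn_integral_fock_norm[OF fock_diff[OF fock_taylor_poly fock_taylor_poly]] ennreal_leI)
  qed
  have "ennreal ((fock_norm (\<lambda>z. f z - taylor_poly f n z))\<^sup>2)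
      = (\<integral>\<^sup>+z. ennreal ((cmod (f z - taylor_poly f n z))\<^sup>2) \<partial>fock_measure)"
    by (simp add: nn_integral_fock_norm[OF fock_diff[OF f fock_taylor_poly]])
  also have "\<dots> = (\<integral>\<^sup>+z. liminf (\<lambda>m. ennreal ((cmod (taylor_poly f m z - taylor_poly f n z))\<^sup>2)) \<partial>fock_measure)"
  proof (rule nn_integral_cong)
    fix z
    have "(\<lambda>m. ennreal ((cmod (taylor_poly f m z - taylor_poly f n z))\<^sup>2))
        \<longlonglongrightarrow> ennreal ((cmod (f z - taylor_poly f n z))\<^sup>2)"
      by (intro tendsto_intros lim)
    then show "ennreal ((cmod (f z - taylor_poly f n z))\<^sup>2)
        = liminf (\<lambda>m. ennreal ((cmod (taylor_poly f m z - taylor_poly f n z))\<^sup>2))"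
      by (rule lim_imp_Liminf[OF sequentially_bot, symmetric])
  qed
  also have "\<dots> \<le> liminf (\<lambda>m. \<integral>\<^sup>+z. ennreal ((cmod (taylor_poly f m z - taylor_poly f n z))\<^sup>2) \<partial>fock_measure)"
    by (rule nn_integral_liminf) measurable
  also have "\<dots> \<le> ennreal (\<epsilon>\<^sup>2 / 2)"
    by (rule Liminf_le) (auto simp: eventually_sequentially intro: bound)
  finally have "(fock_norm (\<lambda>z. f z - taylor_poly f n z))\<^sup>2 \<le> \<epsilon>\<^sup>2 / 2"
    by simp
  also have "\<dots> < \<epsilon>\<^sup>2" using e by simp
  finally show ?thesis
    using e by (intro exI[of _ n]) (rule power2_less_imp_less, auto)
qed

section \<open>Adjoints and the kernel inequality\<close>

lemma op_dom_W_max: "f \<in> op_dom (W_max \<psi> \<phi>) \<longleftrightarrow> f \<in> fock \<and> (\<lambda>z. \<psi> z * f (\<phi> z)) \<in> fock"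
  by (simp add: W_max_def weighted_comp_def)

lemma op_app_W_max: "op_app (W_max \<psi> \<phi>) f = (\<lambda>z. \<psi> z * f (\<phi> z))"
  by (simp add: W_max_def weighted_comp_def)

text \<open>The difference \<open>d\<close> of two candidates is orthogonal to a dense set.
  Approximating the kernel at \<open>a\<close> by elements of the domain then makes the value
  \<open>d a\<close> arbitrarily small.\<close>

lemma adjoint_unique:
  assumes dense: "densely_defined T" and dom: "op_dom T \<subseteq> fock"
    and h: "h \<in> fock" "\<forall>f\<in>op_dom T. fock_inner (op_app T f) g = fock_inner f h"
    and k: "k \<in> fock" "\<forall>f\<in>op_dom T. fock_inner (op_app T f) g = fock_inner f k"
  shows "h = k"
proof
  fix a
  define d where "d = (\<lambda>z. h z - k z)"
  have d: "d \<in> fock"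
    unfolding d_def using h k by (intro fock_diff)
  have orth: "fock_inner f d = 0" if "f \<in> op_dom T" for f
  proof -
    have "f \<in> fock" using that dom by auto
    then have "fock_inner f d = fock_inner f h - fock_inner f k"
      unfolding d_def by (rule fock_inner_diff_right[OF h(1) k(1)])
    then show ?thesis
      using h(2) k(2) that by simp
  qed
  have "cmod (d a) \<le> \<epsilon>" if "\<epsilon> > 0" for \<epsilon>
  proof -
    have "\<epsilon> / (fock_norm d + 1) > 0"
      using that by (simp add: add_nonneg_pos)
    then obtain f where f: "f \<in> op_dom T" "fock_norm (\<lambda>z. fock_kernel a z - f z) < \<epsilon> / (fock_norm d + 1)"
      using dense fock_kernel_mem unfolding densely_defined_def by blast
    have f': "f \<in> fock" using f dom by auto
    have "cmod (d a) = cmod (fock_inner (fock_kernel a) d)"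
      using fock_reproducing[OF d, of a] fock_inner_commute[of "fock_kernel a" d] by simp
    also have "\<dots> = cmod (fock_inner (\<lambda>z. fock_kernel a z - f z) d)"
      by (simp add: fock_inner_diff_left[OF fock_kernel_mem f' d] orth[OF f(1)])
    also have "\<dots> \<le> fock_norm (\<lambda>z. fock_kernel a z - f z) * fock_norm d"
      by (intro fock_Cauchy_Schwarz fock_diff fock_kernel_mem f' d)
    also have "\<dots> \<le> \<epsilon> / (fock_norm d + 1) * fock_norm d"
      using f by (intro mult_right_mono) auto
    also have "\<dots> = \<epsilon> * (fock_norm d / (fock_norm d + 1))"
      by simp
    also have "\<dots> \<le> \<epsilon> * 1"
      using that by (intro mult_left_mono) (auto simp: divide_le_eq_1 add_nonneg_pos)
    also have "\<dots> = \<epsilon>" by simp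
    finally show ?thesis .
  qed
  then have "cmod (d a) \<le> 0"
    by (rule field_le_epsilon[where y = 0, simplified])
  then show "h a = k a"
    by (simp add: d_def)
qed

text \<open>By uniqueness, any \<open>h\<close> that satisfies the duality relation is the value
  selected by \<open>THE\<close>.\<close>

lemma adjoint_op_eq:
  assumes "densely_defined T" "op_dom T \<subseteq> fock"
    and g: "g \<in> fock" and h: "h \<in> fock" "\<forall>f\<in>op_dom T. fock_inner (op_app T f) g = fock_inner f h"
  shows "g \<in> op_dom (adjoint_op T)" "op_app (adjoint_op T) g = h"
proof -
  show "g \<in> op_dom (adjoint_op T)"
    using g h by (auto simp: adjoint_op_def)
  have "(THE h. h \<in> fock \<and> (\<forall>f\<in>op_dom T. fock_inner (op_app T f) g = fock_inner f h)) = h"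
    using h adjoint_unique[OF assms(1,2)] by (intro the_equality) auto
  then show "op_app (adjoint_op T) g = h"
    by (simp add: adjoint_op_def)
qed

text \<open>Pairing with a kernel is evaluation: the image of \<open>f\<close> paired with the
  kernel at \<open>a\<close> is \<open>\<psi> a * f (\<phi> a)\<close>, which is again an evaluation
  of \<open>f\<close>, now at \<open>\<phi> a\<close>.\<close>

lemma adjoint_W_max_kernel:
  assumes dense: "densely_defined (W_max \<psi> \<phi>)"
  shows "fock_kernel a \<in> op_dom (adjoint_op (W_max \<psi> \<phi>))"
    "op_app (adjoint_op (W_max \<psi> \<phi>)) (fock_kernel a)
       = (\<lambda>z. cnj (\<psi> a) * fock_kernel (\<phi> a) z)"
proof -
  let ?T = "W_max \<psi> \<phi>"
  have sub: "op_dom ?T \<subseteq> fock"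
    by (auto simp: op_dom_W_max)
  have "\<forall>f\<in>op_dom ?T. fock_inner (op_app ?T f) (fock_kernel a)
      = fock_inner f (\<lambda>z. cnj (\<psi> a) * fock_kernel (\<phi> a) z)"
    by (auto simp: op_dom_W_max op_app_W_max fock_reproducing fock_inner_scale_right)
  from adjoint_op_eq[OF dense sub fock_kernel_mem fock_scale[OF fock_kernel_mem] this]
  show "fock_kernel a \<in> op_dom (adjoint_op ?T)"
    "op_app (adjoint_op ?T) (fock_kernel a) = (\<lambda>z. cnj (\<psi> a) * fock_kernel (\<phi> a) z)"
    by auto
qed

lemma cohyponormal_kernel_bound:
  assumes "cohyponormal (W_max \<psi> \<phi>)"
  shows "cmod (\<psi> w) * exp (Re (cnj a * \<phi> w))
    \<le> cmod (\<psi> a) * exp ((cmod (\<phi> a))\<^sup>2 / 2 + (cmod w)\<^sup>2 / 2)"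
proof -
  let ?T = "W_max \<psi> \<phi>"
  have dense: "densely_defined ?T"
    using assms by (simp add: cohyponormal_def)
  note adj = adjoint_W_max_kernel[OF dense, of a]
  \<comment> \<open>The inclusion of domains is what puts the kernel into the domain of the operator
    itself, so that its image obeys the pointwise bound.\<close>
  have dom: "fock_kernel a \<in> op_dom ?T"
    and le: "fock_norm (op_app ?T (fock_kernel a)) \<le> fock_norm (op_app (adjoint_op ?T) (fock_kernel a))"
    using assms adj(1) by (auto simp: cohyponormal_def)
  define k where "k = op_app ?T (fock_kernel a)"
  have k: "k = (\<lambda>z. \<psi> z * fock_kernel a (\<phi> z))"
    by (simp add: k_def op_app_W_max)
  then have "k \<in> fock"
    using dom by (simp add: op_dom_W_max)
  then have "cmod (k w) \<le> fock_norm k * exp ((cmod w)\<^sup>2 / 2)"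
    by (rule fock_pointwise_bound)
  also have "fock_norm k \<le> cmod (\<psi> a) * exp ((cmod (\<phi> a))\<^sup>2 / 2)"
    using le by (simp add: adj(2) fock_norm_scale fock_norm_kernel flip: k_def)
  finally show ?thesis
    by (simp add: k norm_mult fock_kernel_def exp_add mult_ac)
qed

text \<open>The Borel--Caratheodory argument: on the circle of radius \<open>r\<close> the function
  \<open>M - Re f\<close> is nonnegative, so its Fourier coefficients are bounded by its mean.\<close>

lemma taylor_coeff_bound_Re:
  assumes f: "f holomorphic_on UNIV" and r: "r \<ge> 0" and n: "n \<ge> 1"
    and M: "\<And>z. cmod z = r \<Longrightarrow> Re (f z) \<le> M"
  shows "cmod (taylor_coeff f n) * r ^ n \<le> 2 * (M - Re (f 0))"
proof -
  define u where "u = (\<lambda>t. f (unit_circle t * of_real r))"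
  define e where "e = unit_circle"
  have pos: "((\<lambda>t. u t * cnj (e t) ^ n) has_integral taylor_coeff f n * of_real r ^ n) {0..1}"
    unfolding u_def e_def by (rule has_integral_unit_circle[OF f])
  have mean: "(u has_integral f 0) {0..1}"
    using has_integral_unit_circle[OF f, of "of_real r" 0] by (simp add: u_def)
  \<comment> \<open>For \<open>n >= 1\<close> the function \<open>z ^ n * f (r * z)\<close> vanishes
    at the origin, hence so does its mean. Conjugated, this says that \<open>cnj u\<close>
    contributes nothing to the \<open>n\<close>-th Fourier coefficient.\<close>
  have "((\<lambda>t. (unit_circle t * 1) ^ n * f (of_real r * (unit_circle t * 1)) * cnj (unit_circle t) ^ 0)
      has_integral taylor_coeff (\<lambda>z. z ^ n * f (of_real r * z)) 0 * 1 ^ 0) {0..1}"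
    using holomorphic_on_affine_comp[OF f, of "of_real r" 0 UNIV]
    by (intro has_integral_unit_circle holomorphic_intros) auto
  then have "((\<lambda>t. u t * e t ^ n) has_integral 0) {0..1}"
    using n by (simp add: u_def e_def mult_ac zero_power)
  from has_integral_cnj[THEN iffD2, OF this]
  have neg: "((\<lambda>t. cnj (u t) * cnj (e t) ^ n) has_integral 0) {0..1}"
    by (simp add: o_def)
  have one: "((\<lambda>t. cnj (e t) ^ n) has_integral 0) {0..1}"
    using has_integral_unit_circle[of "\<lambda>_. 1" 1 n] n by (simp add: e_def)
  \<comment> \<open>Constants have no \<open>n\<close>-th coefficient either, so replacing
    \<open>u\<close> by \<open>2 * (M - Re u)\<close> only changes the sign of the coefficient, and
    the new factor is nonnegative.\<close>
  have "((\<lambda>t. of_real (2 * M) * cnj (e t) ^ n - (u t * cnj (e t) ^ n + cnj (u t) * cnj (e t) ^ n))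
      has_integral of_real (2 * M) * 0 - (taylor_coeff f n * of_real r ^ n + 0)) {0..1}"
    by (intro has_integral_diff has_integral_add has_integral_mult_right pos neg one)
  moreover have "of_real (2 * M) * cnj (e t) ^ n - (u t * cnj (e t) ^ n + cnj (u t) * cnj (e t) ^ n)
      = of_real (2 * (M - Re (u t))) * cnj (e t) ^ n" for t
    using complex_add_cnj[of "u t"] by (simp add: algebra_simps flip: distrib_left distrib_right)
  ultimately have 1: "((\<lambda>t. of_real (2 * (M - Re (u t))) * cnj (e t) ^ n)
      has_integral - (taylor_coeff f n * of_real r ^ n)) {0..1}"
    by simp
  have "((\<lambda>t. Re (u t)) has_integral Re (f 0)) {0..1}"
    using has_integral_Re[OF mean] .
  then have 2: "((\<lambda>t. 2 * (M - Re (u t))) has_integral 2 * (M - Re (f 0))) {0..1}"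
    using has_integral_const_real[of M 0 1]
    by (intro has_integral_mult_right has_integral_diff) auto
  have "cmod (- (taylor_coeff f n * of_real r ^ n)) \<le> 2 * (M - Re (f 0))"
    using has_integral_norm_bound_integral_component[OF 1 2, of 1] M
    by (simp add: norm_mult norm_power u_def e_def r del: of_real_mult of_real_diff)
  then show ?thesis
    using r by (simp only: norm_minus_cancel norm_mult norm_power norm_of_real abs_of_nonneg)
qed

section \<open>Necessity\<close>

text \<open>On the circle of radius \<open>r\<close> the previous bound reads
  \<open>c + r ^ 2\<close>. Dividing by \<open>r ^ n\<close> and letting \<open>r\<close> tend to
  infinity leaves 1 for \<open>n = 2\<close> and 0 for larger \<open>n\<close>.\<close>

lemma taylor_coeff_quadratic_growth:
  assumes f: "f holomorphic_on UNIV" and n: "n \<ge> 2"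
    and M: "\<And>z. Re (f z) \<le> M + (cmod z)\<^sup>2 / 2"
  shows "cmod (taylor_coeff f n) \<le> (if n = 2 then 1 else 0)"
proof -
  define c where "c = 2 * (M - Re (f 0))"
  have "Re (f 0) \<le> M" using M[of 0] by simp
  then have c: "c \<ge> 0" by (simp add: c_def)
  have bound: "cmod (taylor_coeff f n) \<le> c / r ^ n + r ^ 2 / r ^ n" if r: "r > 0" for r
  proof -
    have "cmod (taylor_coeff f n) * r ^ n \<le> 2 * ((M + r\<^sup>2 / 2) - Re (f 0))"
    proof (rule taylor_coeff_bound_Re[OF f])
      show "Re (f z) \<le> M + r\<^sup>2 / 2" if "cmod z = r" for z
        using M[of z] that by simp
    qed (use n r in auto)
    also have "\<dots> = c + r ^ 2"
      by (simp add: c_def algebra_simps)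
    finally show ?thesis
      using r by (simp add: field_simps)
  qed
  have lim: "((\<lambda>r::real. c / r ^ n + r ^ 2 / r ^ n) \<longlongrightarrow> 0 + (if n = 2 then 1 else 0)) at_top"
  proof (rule tendsto_add)
    show "((\<lambda>r::real. c / r ^ n) \<longlongrightarrow> 0) at_top"
      using n by real_asymp
    show "((\<lambda>r::real. r ^ 2 / r ^ n) \<longlongrightarrow> (if n = 2 then 1 else 0)) at_top"
    proof (cases "n = 2")
      case True
      then show ?thesis
        by (auto intro!: tendsto_eventually eventually_mono[OF eventually_gt_at_top[of 0]])
    next
      case False
      then obtain m where "n = m + 3"
        using n by (metis add.commute le_Suc_ex le_antisym not_less_eq_eq numeral_2_eq_2 numeral_3_eq_3)
      then show ?thesis using False by (simp, real_asymp)
    qed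
  qed
  show ?thesis
    using lim by (intro tendsto_lowerbound[OF lim[simplified]])
      (auto intro: eventually_mono[OF eventually_gt_at_top[of 0]] bound)
qed

lemma taylor_poly_3_eq:
  assumes f: "f holomorphic_on UNIV" and z: "\<And>n. n \<ge> 3 \<Longrightarrow> taylor_coeff f n = 0"
  shows "f w = taylor_coeff f 0 + taylor_coeff f 1 * w + taylor_coeff f 2 * w\<^sup>2"
proof -
  have "(\<lambda>n. taylor_coeff f n * w ^ n) sums f w"
    using holomorphic_power_series[of f 0 "cmod w + 1" w] f
    by (auto intro: holomorphic_on_subset)
  moreover have "(\<lambda>n. taylor_coeff f n * w ^ n) sums (\<Sum>n\<in>{..<3}. taylor_coeff f n * w ^ n)"
    using z by (intro sums_finite) auto
  ultimately have "f w = (\<Sum>n\<in>{..<3}. taylor_coeff f n * w ^ n)"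
    by (rule sums_unique2)
  then show ?thesis
    by (simp add: numeral_3_eq_3 numeral_2_eq_2)
qed

lemma taylor_coeff_add_cmult:
  assumes "f holomorphic_on UNIV" "g holomorphic_on UNIV"
  shows "taylor_coeff (\<lambda>z. f z + c * g z) n = taylor_coeff f n + c * taylor_coeff g n"
proof -
  have "(deriv ^^ n) (\<lambda>z. f z + c * g z) 0 = (deriv ^^ n) f 0 + (deriv ^^ n) (\<lambda>z. c * g z) 0"
    using assms by (intro higher_deriv_add[of _ UNIV] holomorphic_intros) auto
  also have "(deriv ^^ n) (\<lambda>z. c * g z) 0 = c * (deriv ^^ n) g 0"
    using assms by (intro higher_deriv_cmult[of _ UNIV]) auto
  finally show ?thesis
    by (simp add: add_divide_distrib)
qed

section \<open>Inequalities between quadratic forms and their coefficients\<close>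

lemma Re_linear_bounded_imp_zero:
  assumes "\<And>a. Re (a * c) \<le> K"
  shows "c = 0"
proof (rule ccontr)
  assume c: "c \<noteq> 0"
  \<comment> \<open>A real multiple of \<open>cnj c\<close>, scaled so that the value exceeds the
    bound by 1.\<close>
  have "Re (of_real ((K + 1) / (cmod c)\<^sup>2) * cnj c * c) = K + 1"
    using c by (simp add: mult.assoc mult.commute[of "cnj c"] flip: complex_norm_square of_real_power)
  then show False
    using assms[of "of_real ((K + 1) / (cmod c)\<^sup>2) * cnj c"] by simp
qed

text \<open>Averaging the inequality at the two square roots of a number cancels the linear term and
  reduces to the linear case.\<close>

lemma Re_quadratic_bounded_imp_zero:
  assumes "\<And>a. Re (c * a\<^sup>2) + Re (d * a) \<le> K"
  shows "c = 0"
proof (rule Re_linear_bounded_imp_zero)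
  fix a
  have "Re (c * (csqrt a)\<^sup>2) + Re (d * csqrt a) \<le> K" "Re (c * (csqrt a)\<^sup>2) - Re (d * csqrt a) \<le> K"
    using assms[of "csqrt a"] assms[of "- csqrt a"] by auto
  then show "Re (a * c) \<le> K"
    by (simp add: mult.commute)
qed

text \<open>The point \<open>w = cnj A * a\<close> maximises
  \<open>Re (cnj a * A * w) - (cmod w)^2 / 2\<close>. Substituting \<open>w = cnj A * a + h\<close>
  cancels every quadratic term in \<open>a\<close> that does not carry \<open>p\<close>, and
  \<open>e\<close> collects the coefficient of \<open>a\<close> that remains. Letting
  \<open>a\<close> range over the plane forces the coefficients of \<open>a\<close> to
  vanish.\<close>

lemma quadratic_coefficients:
  assumes le: "\<And>a w. Re (p * w\<^sup>2 + q * w + cnj a * (A * w + B))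
      \<le> Re (p * a\<^sup>2 + q * a) + (cmod (A * a + B))\<^sup>2 / 2 + (cmod w)\<^sup>2 / 2"
  shows "p = 0" "q * (1 - cnj A) = cnj B * (1 - A)" "cmod q \<le> cmod B"
proof -
  define e where "e = q * cnj A + cnj B - q - A * cnj B"
  have star: "Re (p * (cnj A * a + h)\<^sup>2 - p * a\<^sup>2) + Re (a * e) + Re (q * h)
      \<le> (cmod B)\<^sup>2 / 2 + (cmod h)\<^sup>2 / 2" for a h
  proof -
    have "Re (cnj a * (A * (cnj A * a + h) + B)) =
        (cmod (A * a))\<^sup>2 + Re (A * cnj a * h) + Re (a * cnj B)"
      unfolding cmod_power2 by (simp add: power2_eq_square algebra_simps)
    moreover have "(cmod (A * a + B))\<^sup>2 = (cmod (A * a))\<^sup>2 + (cmod B)\<^sup>2 + 2 * Re (A * a * cnj B)"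
      unfolding cmod_power2 by (simp add: power2_eq_square algebra_simps)
    moreover have "(cmod (cnj A * a + h))\<^sup>2 = (cmod (A * a))\<^sup>2 + (cmod h)\<^sup>2 + 2 * Re (A * cnj a * h)"
      unfolding cmod_power2 by (simp add: power2_eq_square algebra_simps)
    moreover have "Re (a * e) + Re (q * h) = Re (q * (cnj A * a + h)) + Re (a * cnj B) - Re (q * a) - Re (A * a * cnj B)"
      by (simp add: e_def algebra_simps)
    ultimately show ?thesis
      using le[of "cnj A * a + h" a] unfolding plus_complex.sel minus_complex.sel by linarith
  qed
  have c1: "p * ((cnj A)\<^sup>2 - 1) = 0"
  proof (rule Re_quadratic_bounded_imp_zero)
    fix a
    have "p * ((cnj A)\<^sup>2 - 1) * a\<^sup>2 = p * (cnj A * a + 0)\<^sup>2 - p * a\<^sup>2"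
      by (simp add: power_mult_distrib algebra_simps)
    then show "Re (p * ((cnj A)\<^sup>2 - 1) * a\<^sup>2) + Re (e * a) \<le> (cmod B)\<^sup>2 / 2"
      using star[of a 0] by (simp add: mult.commute)
  qed
  \<comment> \<open>Once the quadratic part in \<open>a\<close> is gone, for fixed \<open>h\<close>
    the left side of \<open>star\<close> is real-affine in \<open>a\<close> and bounded
    above.\<close>
  have c2: "2 * p * cnj A * h + e = 0" for h
  proof (rule Re_linear_bounded_imp_zero)
    fix a
    have "p * (cnj A * a + h)\<^sup>2 - p * a\<^sup>2 = p * ((cnj A)\<^sup>2 - 1) * a\<^sup>2 + a * (2 * p * cnj A * h) + p * h\<^sup>2"
      by (simp add: power2_eq_square algebra_simps)
    also have "\<dots> = a * (2 * p * cnj A * h) + p * h\<^sup>2"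
      by (simp only: c1) simp
    finally have "Re (a * (2 * p * cnj A * h) + p * h\<^sup>2) + Re (a * e) + Re (q * h)
        \<le> (cmod B)\<^sup>2 / 2 + (cmod h)\<^sup>2 / 2"
      using star[of a h] by simp
    moreover have "Re (a * (2 * p * cnj A * h + e)) = Re (a * (2 * p * cnj A * h)) + Re (a * e)"
      by (simp add: distrib_left)
    ultimately show "Re (a * (2 * p * cnj A * h + e))
        \<le> (cmod B)\<^sup>2 / 2 + (cmod h)\<^sup>2 / 2 - Re (q * h) - Re (p * h\<^sup>2)"
      by simp
  qed
  have e: "e = 0" using c2[of 0] by simp
  \<comment> \<open>Inserted into \<open>c1\<close>, this leaves \<open>- p = 0\<close>, whether or
    not \<open>A\<close> is zero.\<close>
  then have "p * cnj A = 0" using c2[of 1] by simp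
  then show p: "p = 0"
    using c1 by (auto simp: power2_eq_square)
  show "q * (1 - cnj A) = cnj B * (1 - A)"
    using e by (simp add: e_def algebra_simps)
  \<comment> \<open>The choice \<open>h = cnj q\<close> maximises
    \<open>Re (q * h) - (cmod h)^2 / 2\<close>.\<close>
  have "Re (q * cnj q) \<le> (cmod B)\<^sup>2 / 2 + (cmod q)\<^sup>2 / 2"
    using star[of 0 "cnj q"] p by simp
  moreover have "Re (q * cnj q) = (cmod q)\<^sup>2"
    by (simp add: complex_norm_square[symmetric] flip: of_real_power)
  ultimately have "(cmod q)\<^sup>2 \<le> (cmod B)\<^sup>2"
    by linarith
  then show "cmod q \<le> cmod B"
    by (rule power2_le_imp_le) simp
qed

text \<open>The conclusion treats both cases of the theorem at once: for \<open>A\<close> other than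
  1 the relation determines \<open>D\<close>, while for \<open>A = 1\<close> it is trivial and the
  inequality between \<open>D\<close> and \<open>B\<close> is the condition.\<close>

lemma cohyponormal_imp_form:
  assumes \<phi>: "\<phi> holomorphic_on UNIV" and \<psi>: "\<psi> holomorphic_on UNIV" and ne: "\<psi> \<noteq> (\<lambda>z. 0)"
    and T: "cohyponormal (W_max \<psi> \<phi>)"
  shows "\<exists>A B C D. (\<forall>z. \<phi> z = A * z + B) \<and> (\<forall>z. \<psi> z = C * exp (D * z)) \<and>
    D * (1 - cnj A) = cnj B * (1 - A) \<and> cmod D \<le> cmod B"
proof -
  note bound = cohyponormal_kernel_bound[OF T]
  have nz: "\<psi> a \<noteq> 0" for a
  proof
    assume "\<psi> a = 0"
    then have "cmod (\<psi> w) * exp (Re (cnj a * \<phi> w)) \<le> 0" for w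
      using bound[of w a] by simp
    then have "\<psi> w = 0" for w
      using mult_pos_pos[of "cmod (\<psi> w)" "exp (Re (cnj a * \<phi> w))"] by (force simp: not_le[symmetric])
    then show False using ne by auto
  qed
  obtain g where g: "g holomorphic_on UNIV" "\<And>z. \<psi> z = exp (g z)"
    using holomorphic_logarithm_exists[OF convex_UNIV open_UNIV \<psi>, of 0] nz by (metis UNIV_I)
  have le: "Re (g w + cnj a * \<phi> w) \<le> Re (g a) + (cmod (\<phi> a))\<^sup>2 / 2 + (cmod w)\<^sup>2 / 2" for a w
  proof -
    have "exp (Re (g w + cnj a * \<phi> w)) \<le> exp (Re (g a) + ((cmod (\<phi> a))\<^sup>2 / 2 + (cmod w)\<^sup>2 / 2))"
      using bound[of w a] unfolding g(2) norm_exp_eq_Re plus_complex.sel(1) exp_add .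
    then show ?thesis by simp
  qed
  have coeff: "cmod (taylor_coeff g n + cnj a * taylor_coeff \<phi> n) \<le> (if n = 2 then 1 else 0)"
    if "n \<ge> 2" for n a
    unfolding taylor_coeff_add_cmult[OF g(1) \<phi>, symmetric]
    by (rule taylor_coeff_quadratic_growth[OF _ that, where M = "Re (g a) + (cmod (\<phi> a))\<^sup>2 / 2"])
       (use le g \<phi> in \<open>auto intro!: holomorphic_intros\<close>)
  have g3: "taylor_coeff g n = 0" if "n \<ge> 3" for n
    using coeff[of n 0] that by simp
  \<comment> \<open>The parameter \<open>a = 0\<close> isolates \<open>g\<close>; then
    \<open>a = 1\<close> isolates \<open>\<phi>\<close>.\<close>
  have \<phi>3: "taylor_coeff \<phi> n = 0" if "n \<ge> 3" for n
    using coeff[of n 1] g3[OF that] that by simp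
  \<comment> \<open>In degree two the coefficient is bounded by 1 uniformly in \<open>a\<close>,
    although it depends on \<open>cnj a\<close> affinely.\<close>
  have \<phi>2: "taylor_coeff \<phi> 2 = 0"
  proof (rule Re_linear_bounded_imp_zero)
    fix a
    have "Re (a * taylor_coeff \<phi> 2) \<le> cmod ((taylor_coeff g 2 + a * taylor_coeff \<phi> 2) - taylor_coeff g 2)"
      by (metis add_diff_cancel_left' complex_Re_le_cmod)
    also have "\<dots> \<le> 1 + cmod (taylor_coeff g 2)"
      using coeff[of 2 "cnj a"] by (intro order.trans[OF norm_triangle_ineq4]) auto
    finally show "Re (a * taylor_coeff \<phi> 2) \<le> 1 + cmod (taylor_coeff g 2)" .
  qed
  define A where "A = taylor_coeff \<phi> 1"
  define B where "B = taylor_coeff \<phi> 0"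
  define p where "p = taylor_coeff g 2"
  define q where "q = taylor_coeff g 1"
  define r where "r = taylor_coeff g 0"
  have \<phi>_eq: "\<phi> z = A * z + B" for z
    using taylor_poly_3_eq[OF \<phi> \<phi>3, of z] unfolding \<phi>2 A_def B_def by simp
  have g_eq: "g z = r + q * z + p * z\<^sup>2" for z
    using taylor_poly_3_eq[OF g(1) g3, of z] unfolding p_def q_def r_def .
  have quad: "Re (p * w\<^sup>2 + q * w + cnj a * (A * w + B))
      \<le> Re (p * a\<^sup>2 + q * a) + (cmod (A * a + B))\<^sup>2 / 2 + (cmod w)\<^sup>2 / 2" for a w
    using le[of w a] unfolding \<phi>_eq g_eq by simp
  note q = quadratic_coefficients[OF quad]
  have "\<psi> z = exp r * exp (q * z)" for z
    using g(2)[of z] by (simp add: g_eq q(1) exp_add)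
  then show ?thesis
    using \<phi>_eq q(2,3) by blast
qed

section \<open>Sufficiency\<close>

text \<open>Norm convergence implies pointwise convergence, so the two limits satisfy
  \<open>\<psi> z * f (\<phi> z) = g z\<close>. Since the domain is maximal, \<open>g\<close> being
  in the Fock space already puts \<open>f\<close> into it.\<close>

lemma closed_op_W_max: "closed_op (W_max \<psi> \<phi>)"
  unfolding closed_op_def
proof (intro allI ballI impI, elim conjE)
  fix u :: "nat \<Rightarrow> complex \<Rightarrow> complex" and f g
  let ?T = "W_max \<psi> \<phi>"
  assume f: "f \<in> fock" and g: "g \<in> fock" and u: "\<forall>n. u n \<in> op_dom ?T"
    and uf: "(\<lambda>n. fock_norm (\<lambda>z. u n z - f z)) \<longlonglongrightarrow> 0"
    and ug: "(\<lambda>n. fock_norm (\<lambda>z. op_app ?T (u n) z - g z)) \<longlonglongrightarrow> 0"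
  have pointwise: "(\<lambda>n. v n a) \<longlonglongrightarrow> k a"
    if "\<And>n. v n \<in> fock" "k \<in> fock" "(\<lambda>n. fock_norm (\<lambda>z. v n z - k z)) \<longlonglongrightarrow> 0"
    for v :: "nat \<Rightarrow> complex \<Rightarrow> complex" and k a
  proof (rule Lim_null_comparison[THEN LIM_zero_cancel])
    show "\<forall>\<^sub>F n in sequentially. norm (v n a - k a)
        \<le> fock_norm (\<lambda>z. v n z - k z) * exp ((cmod a)\<^sup>2 / 2)"
      using fock_pointwise_bound[OF fock_diff[OF that(1,2)]] by simp
    show "(\<lambda>n. fock_norm (\<lambda>z. v n z - k z) * exp ((cmod a)\<^sup>2 / 2)) \<longlonglongrightarrow> 0"
      using tendsto_mult_right[OF that(3), of "exp ((cmod a)\<^sup>2 / 2)"] by simp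
  qed
  have "\<psi> z * f (\<phi> z) = g z" for z
  proof (rule LIMSEQ_unique)
    show "(\<lambda>n. \<psi> z * u n (\<phi> z)) \<longlonglongrightarrow> \<psi> z * f (\<phi> z)"
      using u f uf by (intro tendsto_intros pointwise) (auto simp: op_dom_W_max)
    show "(\<lambda>n. \<psi> z * u n (\<phi> z)) \<longlonglongrightarrow> g z"
      using pointwise[of "\<lambda>n. op_app ?T (u n)" g z] u g ug by (simp add: op_dom_W_max op_app_W_max)
  qed
  then have "(\<lambda>z. \<psi> z * f (\<phi> z)) = g" by auto
  then show "f \<in> op_dom ?T \<and> op_app ?T f = g"
    using f g by (simp add: op_dom_W_max op_app_W_max)
qed

text \<open>The constants are left unrelated here: density and the formula for the adjoint hold for
  all of them, and the relation enters when norms are compared.\<close>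

locale affine_symbol =
  fixes \<psi> \<phi> :: "complex \<Rightarrow> complex" and A B C D :: complex
  assumes phi: "\<phi> z = A * z + B" and psi: "\<psi> z = C * exp (D * z)"
begin

text \<open>Polynomials are mapped to sums of polynomials times an exponential, which lie in the
  Fock space.\<close>

lemma densely_defined: "densely_defined (W_max \<psi> \<phi>)"
  unfolding densely_defined_def
proof (intro ballI allI impI)
  fix f \<epsilon> assume f: "f \<in> fock" and "(\<epsilon>::real) > 0"
  then obtain n where n: "fock_norm (\<lambda>z. f z - taylor_poly f n z) < \<epsilon>"
    using taylor_poly_dense by blast
  have "(\<lambda>z. \<psi> z * taylor_poly f n (\<phi> z))
      = (\<lambda>z. \<Sum>k<n. taylor_coeff f k * (C * exp (D * z) * (A * z + B) ^ k))"
    by (simp add: taylor_poly_def phi psi sum_distrib_left mult_ac)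
  also have "\<dots> \<in> fock"
    by (intro fock_sum fock_scale fock_affine_power_exp)
  finally have "taylor_poly f n \<in> op_dom (W_max \<psi> \<phi>)"
    by (simp add: op_dom_W_max fock_taylor_poly)
  with n show "\<exists>g\<in>op_dom (W_max \<psi> \<phi>). fock_norm (\<lambda>z. f z - g z) < \<epsilon>"
    by blast
qed

text \<open>Kernels are mapped to multiples of kernels, so they lie in the domain and can be used as
  test functions for the adjoint.\<close>

lemma W_max_kernel:
  "(\<lambda>z. \<psi> z * fock_kernel a (\<phi> z)) = (\<lambda>z. C * exp (cnj a * B) * fock_kernel (cnj A * a + cnj D) z)"
  by (simp add: phi psi fock_kernel_def exp_add algebra_simps flip: exp_add)

text \<open>The value \<open>h a\<close> is the conjugate of the pairing of the kernel at
  \<open>a\<close> with \<open>h\<close>. Duality moves the operator onto that kernel, and the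
  reproducing property evaluates \<open>g\<close> at the new point. This gives the formula on the
  whole domain of the adjoint.\<close>

lemma adjoint_eq:
  assumes "g \<in> op_dom (adjoint_op (W_max \<psi> \<phi>))"
  shows "g \<in> fock" "op_app (adjoint_op (W_max \<psi> \<phi>)) g \<in> fock"
    "op_app (adjoint_op (W_max \<psi> \<phi>)) g = (\<lambda>z. cnj C * exp (cnj B * z) * g (cnj A * z + cnj D))"
proof -
  let ?T = "W_max \<psi> \<phi>"
  obtain h where g: "g \<in> fock" and h: "h \<in> fock" "\<forall>f\<in>op_dom ?T. fock_inner (op_app ?T f) g = fock_inner f h"
    using assms by (auto simp: adjoint_op_def)
  have sub: "op_dom ?T \<subseteq> fock"
    by (auto simp: op_dom_W_max)
  have adj: "op_app (adjoint_op ?T) g = h"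
    by (rule adjoint_op_eq[OF densely_defined sub g h])
  have "h a = cnj C * exp (cnj B * a) * g (cnj A * a + cnj D)" for a
  proof -
    have "fock_kernel a \<in> op_dom ?T"
      unfolding op_dom_W_max W_max_kernel by (intro conjI fock_scale fock_kernel_mem)
    then have "fock_inner (op_app ?T (fock_kernel a)) g = fock_inner (fock_kernel a) h"
      using h(2) by blast
    then have *: "fock_inner (fock_kernel a) h
        = C * exp (cnj a * B) * fock_inner (fock_kernel (cnj A * a + cnj D)) g"
      unfolding op_app_W_max W_max_kernel fock_inner_scale_left by simp
    have "h a = cnj (fock_inner (fock_kernel a) h)"
      using fock_reproducing[OF h(1), of a] by (simp add: fock_inner_commute[of h])
    also have "\<dots> = cnj C * exp (cnj B * a) * fock_inner g (fock_kernel (cnj A * a + cnj D))"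
      unfolding * by (simp add: exp_cnj mult.commute fock_inner_commute[of g])
    also have "\<dots> = cnj C * exp (cnj B * a) * g (cnj A * a + cnj D)"
      by (simp add: fock_reproducing[OF g])
    finally show ?thesis .
  qed
  then show "g \<in> fock" "op_app (adjoint_op ?T) g \<in> fock"
    "op_app (adjoint_op ?T) g = (\<lambda>z. cnj C * exp (cnj B * z) * g (cnj A * z + cnj D))"
    using g h adj by auto
qed

end

text \<open>The two brackets are the exponents of the weighted integrands at \<open>\<sigma>\<close>
  and at \<open>z\<close>. Their difference is constant in \<open>z\<close> when \<open>A\<close> is
  nonzero; the factor \<open>(cmod A)^2\<close> clears the denominators of
  \<open>\<sigma>\<close>.\<close>

lemma affine_exponent_identity:
  fixes A B D z \<sigma> :: complex
  assumes rel: "D * (1 - cnj A) = cnj B * (1 - A)" and \<sigma>: "cnj A * \<sigma> + cnj D = A * z + B"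
  shows "(cmod A)\<^sup>2 * ((2 * Re (cnj B * \<sigma>) - (cmod \<sigma>)\<^sup>2) - (2 * Re (D * z) - (cmod z)\<^sup>2))
    = (cmod B)\<^sup>2 - (cmod D)\<^sup>2"
proof -
  have rel': "cnj D * (1 - A) = B * (1 - cnj A)"
    using arg_cong[OF rel, of cnj] by simp
  have \<sigma>': "A * cnj \<sigma> + D = cnj A * cnj z + cnj B"
    using arg_cong[OF \<sigma>, of cnj] by simp
  \<comment> \<open>Each number and its conjugate become independent variables, with the hypotheses
    listed together with their conjugates; a polynomial identity remains.\<close>
  have poly: "a * a' * ((b' * s + b * s' - s * s') - (d * x + d' * x' - x * x')) = b * b' - d * d'"
    if "d * (1 - a') = b' * (1 - a)" "d' * (1 - a) = b * (1 - a')"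
      "a' * s + d' = a * x + b" "a * s' + d = a' * x' + b'"
    for a a' b b' d d' s s' x x' :: complex
    using that by algebra
  have "complex_of_real ((cmod A)\<^sup>2 * ((2 * Re (cnj B * \<sigma>) - (cmod \<sigma>)\<^sup>2) - (2 * Re (D * z) - (cmod z)\<^sup>2)))
      = A * cnj A * ((cnj B * \<sigma> + B * cnj \<sigma> - \<sigma> * cnj \<sigma>) - (D * z + cnj D * cnj z - z * cnj z))"
    using complex_add_cnj[of "cnj B * \<sigma>"] complex_add_cnj[of "D * z"]
    by (simp add: complex_norm_square del: of_real_power)
  also have "\<dots> = B * cnj B - D * cnj D"
    by (rule poly[OF rel rel' \<sigma> \<sigma>'])
  also have "\<dots> = complex_of_real ((cmod B)\<^sup>2 - (cmod D)\<^sup>2)"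
    by (simp add: complex_norm_square del: of_real_power)
  finally show ?thesis
    by (simp only: of_real_eq_iff)
qed

text \<open>The rigid motion \<open>\<sigma>\<close> with \<open>cnj A * \<sigma> z + cnj D = A * z + B\<close> makes the two
  weighted compositions of \<open>g\<close> comparable pointwise.\<close>

lemma weighted_comp_le_adjoint:
  fixes A B C D :: complex
  assumes g: "g \<in> fock" and rel: "D * (1 - cnj A) = cnj B * (1 - A)" and DB: "cmod D \<le> cmod B"
  defines "k \<equiv> (\<lambda>z. C * exp (D * z) * g (A * z + B))"
    and "h \<equiv> (\<lambda>z. cnj C * exp (cnj B * z) * g (cnj A * z + cnj D))"
  assumes h: "h \<in> fock"
  shows "k \<in> fock" "fock_norm k \<le> fock_norm h"
proof -
  have khol: "k holomorphic_on UNIV"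
    unfolding k_def using fock_memD(1)[OF g] by (intro holomorphic_intros holomorphic_on_affine_comp) auto
  note [measurable] = holomorphic_imp_borel[OF khol] fock_memD(3)[OF h]
  have main: "k \<in> fock \<and> fock_norm k \<le> fock_norm h"
  proof (cases "A = 0")
    \<comment> \<open>Here both functions evaluate \<open>g\<close> at one constant point, no rigid
      motion exists, and the relation gives \<open>D = cnj B\<close>; so the moduli agree.\<close>
    case True
    then have "cmod (k z) = cmod (h z)" for z
      using rel by (simp add: k_def h_def norm_mult)
    then show ?thesis
      using h khol by (simp add: fock_def fock_norm_eq)
  next
    case False
    \<comment> \<open>Solving \<open>cnj A * \<sigma> + cnj D = A * z + B\<close> for
      \<open>\<sigma>\<close> gives \<open>c * z + d\<close>; \<open>c\<close> has modulus 1 because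
      conjugation preserves the modulus.\<close>
    define c where "c = A / cnj A"
    define d where "d = (B - cnj D) / cnj A"
    define H where "H = (\<lambda>z. exp (- (cmod z)\<^sup>2) / pi * (cmod (h z))\<^sup>2)"
    have [measurable]: "H \<in> borel_measurable borel"
      unfolding H_def by measurable
    have c: "cmod c = 1"
      using False by (simp add: c_def norm_divide)
    have le: "exp (- (cmod z)\<^sup>2) / pi * (cmod (k z))\<^sup>2 \<le> H (c * z + d)" for z
    proof -
      define \<sigma> where "\<sigma> = c * z + d"
      have \<sigma>: "cnj A * \<sigma> + cnj D = A * z + B"
        using False by (simp add: \<sigma>_def c_def d_def field_simps)
      have "(cmod A)\<^sup>2 * ((2 * Re (cnj B * \<sigma>) - (cmod \<sigma>)\<^sup>2) - (2 * Re (D * z) - (cmod z)\<^sup>2)) \<ge> 0"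
        unfolding affine_exponent_identity[OF rel \<sigma>] using DB by (simp add: power_mono)
      then have "2 * Re (D * z) - (cmod z)\<^sup>2 \<le> 2 * Re (cnj B * \<sigma>) - (cmod \<sigma>)\<^sup>2"
        using False by (simp add: zero_le_mult_iff)
      then have "exp (2 * Re (D * z) - (cmod z)\<^sup>2) \<le> exp (2 * Re (cnj B * \<sigma>) - (cmod \<sigma>)\<^sup>2)"
        by simp
      then have "exp (- (cmod z)\<^sup>2) * (exp (Re (D * z)))\<^sup>2 \<le> exp (- (cmod \<sigma>)\<^sup>2) * (exp (Re (cnj B * \<sigma>)))\<^sup>2"
        by (simp only: exp_double[symmetric] exp_add[symmetric]) simp
      then have "(exp (- (cmod z)\<^sup>2) * (exp (Re (D * z)))\<^sup>2) * ((cmod C)\<^sup>2 * (cmod (g (A * z + B)))\<^sup>2)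
          \<le> (exp (- (cmod \<sigma>)\<^sup>2) * (exp (Re (cnj B * \<sigma>)))\<^sup>2) * ((cmod C)\<^sup>2 * (cmod (g (A * z + B)))\<^sup>2)"
        by (rule mult_right_mono) simp
      then have "exp (- (cmod z)\<^sup>2) * (cmod (k z))\<^sup>2 \<le> exp (- (cmod \<sigma>)\<^sup>2) * (cmod (h \<sigma>))\<^sup>2"
        unfolding k_def h_def \<sigma> norm_mult norm_exp_eq_Re power_mult_distrib complex_mod_cnj
        by (simp only: mult_ac)
      then show ?thesis
        by (simp add: H_def \<sigma>_def divide_right_mono)
    qed
    have "integrable lborel H"
      using fock_memD(2)[OF h] by (simp add: integrable_fock_measure_iff H_def)
    then have int: "integrable lborel (\<lambda>z. H (c * z + d))"
      by (simp add: integrable_rigid_motion[OF _ c])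
    have intk: "integrable lborel (\<lambda>z. exp (- (cmod z)\<^sup>2) / pi * (cmod (k z))\<^sup>2)"
      by (rule Bochner_Integration.integrable_bound[OF int])
         (use le in \<open>auto intro: order_trans[OF _ abs_ge_self]\<close>)
    then have k: "k \<in> fock"
      using khol by (simp add: fock_def integrable_fock_measure_iff)
    have "(LINT z|fock_measure. (cmod (k z))\<^sup>2) = (LINT z|lborel. exp (- (cmod z)\<^sup>2) / pi * (cmod (k z))\<^sup>2)"
      by (subst integral_fock_measure) auto
    also have "\<dots> \<le> (LINT z|lborel. H (c * z + d))"
      by (rule integral_mono[OF intk int le])
    also have "\<dots> = (LINT z|lborel. H z)"
      by (rule integral_rigid_motion[OF _ c]) measurable
    also have "\<dots> = (LINT z|fock_measure. (cmod (h z))\<^sup>2)"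
      by (subst integral_fock_measure) (auto simp: H_def)
    finally show ?thesis
      using k by (simp add: fock_norm_eq)
  qed
  then show "k \<in> fock" "fock_norm k \<le> fock_norm h" by auto
qed

lemma (in affine_symbol) cohyponormal_W_max:
  assumes "D * (1 - cnj A) = cnj B * (1 - A)" "cmod D \<le> cmod B"
  shows "cohyponormal (W_max \<psi> \<phi>)"
  unfolding cohyponormal_def
proof (intro conjI subsetI ballI linear_op_W_max closed_op_W_max densely_defined)
  let ?T = "W_max \<psi> \<phi>"
  fix g assume "g \<in> op_dom (adjoint_op ?T)"
  note adj = adjoint_eq[OF this]
  have app: "op_app ?T g = (\<lambda>z. C * exp (D * z) * g (A * z + B))"
    by (simp add: op_app_W_max phi psi)
  note le = weighted_comp_le_adjoint[OF adj(1) assms adj(2)[unfolded adj(3)]]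
  show "fock_norm (op_app ?T g) \<le> fock_norm (op_app (adjoint_op ?T) g)"
    unfolding app adj(3) by (rule le(2))
  show "g \<in> op_dom ?T"
    using adj(1) le(1) by (simp add: op_dom_W_max phi psi)
qed

section \<open>Passing between the uniform relation and the two cases\<close>

theorem theorem6p2:
  fixes \<psi> \<phi> :: "complex \<Rightarrow> complex"
  assumes "\<phi> holomorphic_on UNIV" and "\<psi> holomorphic_on UNIV"
    and "\<psi> \<noteq> (\<lambda>z. 0)"
  shows "cohyponormal (W_max \<psi> \<phi>) \<longleftrightarrow>
    (\<exists>A B C D :: complex.
       ((\<forall>z. \<phi> z = A * z + B) \<and> A \<noteq> 1 \<and> (\<forall>z. \<psi> z = C * exp (D * z)) \<and>
          D = cnj B * (1 - A) * inverse (1 - cnj A))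
     \<or> ((\<forall>z. \<phi> z = z + B) \<and> (\<forall>z. \<psi> z = C * exp (D * z)) \<and> cmod B \<ge> cmod D))"
  (is "_ \<longleftrightarrow> ?R")
proof
  assume "cohyponormal (W_max \<psi> \<phi>)"
  from cohyponormal_imp_form[OF assms this] obtain A B C D
    where form: "\<forall>z. \<phi> z = A * z + B" "\<forall>z. \<psi> z = C * exp (D * z)"
      and rel: "D * (1 - cnj A) = cnj B * (1 - A)" and le: "cmod D \<le> cmod B"
    by blast
  show ?R
  proof (cases "A = 1")
    case True
    then show ?thesis
      using form le by (intro exI[of _ A] exI[of _ B] exI[of _ C] exI[of _ D]) simp
  next
    case False
    then have "1 - cnj A \<noteq> 0"
      by (metis complex_cnj_cnj complex_cnj_one eq_iff_diff_eq_0)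
    then have "D = cnj B * (1 - A) * inverse (1 - cnj A)"
      using rel by (simp add: field_simps)
    then show ?thesis
      using form False by (intro exI[of _ A] exI[of _ B] exI[of _ C] exI[of _ D]) simp
  qed
next
  assume ?R
  then obtain A B C D where
    cases: "((\<forall>z. \<phi> z = A * z + B) \<and> A \<noteq> 1 \<and> (\<forall>z. \<psi> z = C * exp (D * z)) \<and>
          D = cnj B * (1 - A) * inverse (1 - cnj A))
     \<or> ((\<forall>z. \<phi> z = z + B) \<and> (\<forall>z. \<psi> z = C * exp (D * z)) \<and> cmod B \<ge> cmod D)"
    by blast
  then show "cohyponormal (W_max \<psi> \<phi>)"
  proof (elim disjE conjE)
    assume phi: "\<forall>z. \<phi> z = A * z + B" and "A \<noteq> 1" and psi: "\<forall>z. \<psi> z = C * exp (D * z)"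
      and D: "D = cnj B * (1 - A) * inverse (1 - cnj A)"
    then interpret affine_symbol \<psi> \<phi> A B C D
      by unfold_locales auto
    have ne: "1 - cnj A \<noteq> 0"
      using \<open>A \<noteq> 1\<close> by (metis complex_cnj_cnj complex_cnj_one eq_iff_diff_eq_0)
    have n: "cmod (1 - cnj A) = cmod (1 - A)"
      by (metis complex_cnj_diff complex_cnj_one complex_mod_cnj)
    show ?thesis
    proof (rule cohyponormal_W_max)
      show "D * (1 - cnj A) = cnj B * (1 - A)"
        using ne by (simp add: D)
      \<comment> \<open>Equality holds in this case, because \<open>1 - A\<close> and
        \<open>1 - cnj A\<close> have the same modulus.\<close>
      show "cmod D \<le> cmod B"
        using right_inverse[of "cmod (1 - cnj A)"] ne
        by (simp only: D norm_mult norm_inverse n[symmetric] complex_mod_cnj mult.assoc norm_eq_zero) simp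
    qed
  next
    assume phi: "\<forall>z. \<phi> z = z + B" and psi: "\<forall>z. \<psi> z = C * exp (D * z)" and le: "cmod D \<le> cmod B"
    then interpret affine_symbol \<psi> \<phi> 1 B C D
      by unfold_locales auto
    show ?thesis
      using le by (intro cohyponormal_W_max) auto
  qed
qed

end
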